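(* Let $\mu\in\Bbbk^\times$ with $\operatorname{ord}(\mu)=k>1$, and let $A$ be either the quantum plane $\Bbbk_\mu[u,v]=\Bbbk\langle u,v\mid uv-\mu vu\rangle$ or the first quantum Weyl algebra $A_1^\mu(\Bbbk)=\Bbbk\langle u,v\mid uv-\mu vu-1\rangle$. Then the generalized Taft algebra $T=T_n(\lambda,m,0)$ (with $m\ge 2$) acts linearly and inner faithfully on $A$ if and only if $n=\operatorname{lcm}(k,m)$ and the action is given by one of the following: (a) $g\cdot u=\mu u$, $g\cdot v=\lambda^{-1}\mu v$, $x\cdot u=0$, $x\cdot v=\eta u$ for some $\eta\in\Bbbk^\times$, and if $A=A_1^\mu(\Bbbk)$ then $\lambda=\mu^2$; or (b) $g\cdot u=\lambda^{-1}\mu^{-1}u$, $g\cdot v=\mu^{-1}v$, $x\cdot u=\eta v$ for some $\eta\in\Bbbk^\times$, $x\cdot v=0$, and if $A=A_1^\mu(\Bbbk)$ then $\lambda=\mu^{-2}$.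
   Context: $\Bbbk$ is an algebraically closed field of characteristic zero; $\operatorname{ord}$ denotes multiplicative order. Generalized Taft algebra: for $n,m\in\mathbb N$ with $m\mid n$ and $\lambda\in\Bbbk$ a primitive $m$th root of unity, $T_n(\lambda,m,0)$ is the Hopf algebra generated by a grouplike element $g$ and an element $x$ with $\Delta(x)=g\otimes x+x\otimes 1$, subject to $g^n=1$, $x^m=0$, $gx=\lambda xg$. A Hopf algebra $H$ acts on an algebra $A$ if $A$ is a left $H$-module algebra, i.e. $h\cdot 1=\varepsilon(h)1$ and $h\cdot(aa')=\sum(h_1\cdot a)(h_2\cdot a')$. The action is inner faithful if no nonzero Hopf ideal of $H$ annihilates $A$. The action of $T$ on $A$ is linear if $g$ and $x$ map $\operatorname{Span}_\Bbbk\{u,v\}$ into itself. *)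

theory Defs
  imports "HOL-Library.Poly_Mapping" "HOL-Computational_Algebra.Polynomial"
begin

text \<open>The multiplicative order; it is \<open>0\<close> if no positive power of \<open>a\<close> is \<open>1\<close>.\<close>

definition mult_order :: "'a::monoid_mult \<Rightarrow> nat" where
  "mult_order a = (if \<exists>j>0. a ^ j = 1 then (LEAST j. 0 < j \<and> a ^ j = 1) else 0)"


section \<open>Formal linear combinations\<close>

text \<open>The type \<open>'p \<Rightarrow>\<^sub>0 'k\<close> is the vector space with basis \<open>'p\<close>.\<close>

definition fscale :: "'k::field \<Rightarrow> ('p \<Rightarrow>\<^sub>0 'k) \<Rightarrow> ('p \<Rightarrow>\<^sub>0 'k)" where
  "fscale c t = Poly_Mapping.map (\<lambda>x. c * x) t"

lemma lookup_fscale [simp]: "Poly_Mapping.lookup (fscale c t) p = c * Poly_Mapping.lookup t p"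
  by (simp add: fscale_def Poly_Mapping.map.rep_eq when_def)

global_interpretation formal: vector_space fscale
  by unfold_locales (simp_all add: poly_mapping_eq_iff fun_eq_iff lookup_add algebra_simps)

definition basis_vec :: "'p \<Rightarrow> ('p \<Rightarrow>\<^sub>0 'k::field)" where
  "basis_vec p = Poly_Mapping.single p 1"

text \<open>The linear extension of a map from the basis into a vector space with scalar
  multiplication \<open>s\<close>.\<close>

definition lin_ext :: "('k::field \<Rightarrow> 'b::ab_group_add \<Rightarrow> 'b) \<Rightarrow> ('p \<Rightarrow> 'b) \<Rightarrow> ('p \<Rightarrow>\<^sub>0 'k) \<Rightarrow> 'b" where
  "lin_ext s f t = (\<Sum>p\<in>Poly_Mapping.keys t. s (Poly_Mapping.lookup t p) (f p))"


section \<open>Algebras, ideals, presentations\<close>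

locale k_algebra = vector_space scale
  for scale :: "'k::field \<Rightarrow> 'a::ring_1 \<Rightarrow> 'a" +
  assumes scale_mult_left: "scale c (a * b) = scale c a * b"
    and scale_mult_right: "scale c (a * b) = a * scale c b"

definition two_sided_ideal :: "'a::ring_1 set \<Rightarrow> bool" where
  "two_sided_ideal I \<longleftrightarrow> 0 \<in> I \<and> (\<forall>a\<in>I. \<forall>b\<in>I. a + b \<in> I) \<and>
     (\<forall>a\<in>I. \<forall>r. r * a \<in> I \<and> a * r \<in> I)"

definition ideal_generated :: "'a::ring_1 set \<Rightarrow> 'a set" where
  "ideal_generated R = \<Inter>{I. two_sided_ideal I \<and> R \<subseteq> I}"

text \<open>The free monoid on \<open>'x\<close>, written additively because the convolution product on
  \<open>'p \<Rightarrow>\<^sub>0 'k\<close> comes from the addition of \<open>'p\<close>. With it \<open>'x word \<Rightarrow>\<^sub>0 'k\<close> is the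
  free algebra on \<open>'x\<close>, whose scalar multiplication is \<open>fscale\<close>.\<close>

datatype 'x word = Word (letters: "'x list")

instantiation word :: (type) monoid_add
begin

definition zero_word :: "'x word" where
  "zero_word = Word []"

definition plus_word :: "'x word \<Rightarrow> 'x word \<Rightarrow> 'x word" where
  "plus_word w w' = Word (letters w @ letters w')"

instance
  by intro_classes (simp_all add: zero_word_def plus_word_def)

end

definition free_gen :: "'x \<Rightarrow> ('x word \<Rightarrow>\<^sub>0 'k::field)" where
  "free_gen i = basis_vec (Word [i])"

text \<open>The algebra homomorphism from the free algebra sending the generator \<open>i\<close> to \<open>e i\<close>.\<close>

definition free_eval ::
    "('k::field \<Rightarrow> 'a::ring_1 \<Rightarrow> 'a) \<Rightarrow> ('x \<Rightarrow> 'a) \<Rightarrow> ('x word \<Rightarrow>\<^sub>0 'k) \<Rightarrow> 'a" where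
  "free_eval scale e = lin_ext scale (\<lambda>w. prod_list (map e (letters w)))"

text \<open>The algebra is the quotient of the free algebra by the ideal generated by \<open>R\<close>, the
  classes of the generators being the elements \<open>e i\<close>.\<close>

definition presented_by ::
    "('k::field \<Rightarrow> 'a::ring_1 \<Rightarrow> 'a) \<Rightarrow> ('x \<Rightarrow> 'a) \<Rightarrow> ('x word \<Rightarrow>\<^sub>0 'k) set \<Rightarrow> bool" where
  "presented_by scale e R \<longleftrightarrow>
     k_algebra scale \<and>
     surj (free_eval scale e) \<and>
     {f. free_eval scale e f = 0} = ideal_generated R"

datatype gen = Gen1 | Gen2

definition quantum_plane ::
    "'k::field \<Rightarrow> ('k \<Rightarrow> 'a::ring_1 \<Rightarrow> 'a) \<Rightarrow> 'a \<Rightarrow> 'a \<Rightarrow> bool" where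
  "quantum_plane \<mu> scale u v \<longleftrightarrow>
     (let U = free_gen Gen1; V = free_gen Gen2 in
      presented_by scale (case_gen u v) {U * V - fscale \<mu> (V * U)})"

definition quantum_weyl ::
    "'k::field \<Rightarrow> ('k \<Rightarrow> 'a::ring_1 \<Rightarrow> 'a) \<Rightarrow> 'a \<Rightarrow> 'a \<Rightarrow> bool" where
  "quantum_weyl \<mu> scale u v \<longleftrightarrow>
     (let U = free_gen Gen1; V = free_gen Gen2 in
      presented_by scale (case_gen u v) {U * V - fscale \<mu> (V * U) - 1})"


section \<open>Tensor powers\<close>

text \<open>\<open>H \<otimes> H\<close> is the quotient of the space of formal combinations of pairs by the span of the
  bilinearity relations, and \<open>H \<otimes> H \<otimes> H\<close> the corresponding quotient for triples. Tensors are
  handled through representatives. In \<open>slot_relations\<close> the function \<open>j\<close> inserts a vector into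
  one slot, the other entries being fixed.\<close>

definition slot_relations ::
    "('k::field \<Rightarrow> 'h::ab_group_add \<Rightarrow> 'h) \<Rightarrow> ('h \<Rightarrow> 'p) \<Rightarrow> ('p \<Rightarrow>\<^sub>0 'k) set" where
  "slot_relations scale j =
     {basis_vec (j (a + b)) - basis_vec (j a) - basis_vec (j b) | a b. True} \<union>
     {basis_vec (j (scale c a)) - fscale c (basis_vec (j a)) | c a. True}"

definition tensor2_eq ::
    "('k::field \<Rightarrow> 'h::ab_group_add \<Rightarrow> 'h) \<Rightarrow> ('h \<times> 'h \<Rightarrow>\<^sub>0 'k) \<Rightarrow> ('h \<times> 'h \<Rightarrow>\<^sub>0 'k) \<Rightarrow> bool" where
  "tensor2_eq scale s t \<longleftrightarrow>
     s - t \<in> formal.span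
       ((\<Union>b. slot_relations scale (\<lambda>h. (h, b))) \<union>
        (\<Union>a. slot_relations scale (\<lambda>h. (a, h))))"

definition tensor3_eq ::
    "('k::field \<Rightarrow> 'h::ab_group_add \<Rightarrow> 'h) \<Rightarrow>
     ('h \<times> 'h \<times> 'h \<Rightarrow>\<^sub>0 'k) \<Rightarrow> ('h \<times> 'h \<times> 'h \<Rightarrow>\<^sub>0 'k) \<Rightarrow> bool" where
  "tensor3_eq scale s t \<longleftrightarrow>
     s - t \<in> formal.span
       ((\<Union>b c. slot_relations scale (\<lambda>h. (h, b, c))) \<union>
        (\<Union>a c. slot_relations scale (\<lambda>h. (a, h, c))) \<union>
        (\<Union>a b. slot_relations scale (\<lambda>h. (a, b, h))))"

definition tensor_mult ::
    "('h::ring_1 \<times> 'h \<Rightarrow>\<^sub>0 'k::field) \<Rightarrow> ('h \<times> 'h \<Rightarrow>\<^sub>0 'k) \<Rightarrow> ('h \<times> 'h \<Rightarrow>\<^sub>0 'k)" where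
  "tensor_mult s t =
     lin_ext fscale (\<lambda>(a, b). lin_ext fscale (\<lambda>(c, d). basis_vec (a * c, b * d)) t) s"


section \<open>Hopf algebras and their actions\<close>

text \<open>\<open>\<Delta> h\<close> is a representative of the coproduct of \<open>h\<close>, so for instance
  \<open>lin_ext scale (\<lambda>(a, b). S a * b) (\<Delta> h)\<close> is the Sweedler sum of \<open>S h\<^sub>1 * h\<^sub>2\<close>.\<close>

locale hopf_algebra = k_algebra scale
  for scale :: "'k::field \<Rightarrow> 'h::ring_1 \<Rightarrow> 'h" +
  fixes \<Delta> :: "'h \<Rightarrow> ('h \<times> 'h \<Rightarrow>\<^sub>0 'k)"
    and \<epsilon> :: "'h \<Rightarrow> 'k"
    and S :: "'h \<Rightarrow> 'h"
  assumes comult_add: "tensor2_eq scale (\<Delta> (a + b)) (\<Delta> a + \<Delta> b)"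
    and comult_scale: "tensor2_eq scale (\<Delta> (scale c a)) (fscale c (\<Delta> a))"
    and comult_one: "tensor2_eq scale (\<Delta> 1) (basis_vec (1, 1))"
    and comult_mult: "tensor2_eq scale (\<Delta> (a * b)) (tensor_mult (\<Delta> a) (\<Delta> b))"
    and coassoc:
      "tensor3_eq scale
         (lin_ext fscale (\<lambda>(a, b). lin_ext fscale (\<lambda>(a1, a2). basis_vec (a1, a2, b)) (\<Delta> a)) (\<Delta> h))
         (lin_ext fscale (\<lambda>(a, b). lin_ext fscale (\<lambda>(b1, b2). basis_vec (a, b1, b2)) (\<Delta> b)) (\<Delta> h))"
    and counit_linear: "Vector_Spaces.linear scale (*) \<epsilon>"
    and counit_one: "\<epsilon> 1 = 1"
    and counit_mult: "\<epsilon> (a * b) = \<epsilon> a * \<epsilon> b"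
    and counit_left: "lin_ext scale (\<lambda>(a, b). scale (\<epsilon> a) b) (\<Delta> h) = h"
    and counit_right: "lin_ext scale (\<lambda>(a, b). scale (\<epsilon> b) a) (\<Delta> h) = h"
    and antipode_linear: "Vector_Spaces.linear scale scale S"
    and antipode_left: "lin_ext scale (\<lambda>(a, b). S a * b) (\<Delta> h) = scale (\<epsilon> h) 1"
    and antipode_right: "lin_ext scale (\<lambda>(a, b). a * S b) (\<Delta> h) = scale (\<epsilon> h) 1"

text \<open>The condition on \<open>\<Delta> h\<close> says that it lies in \<open>I \<otimes> H + H \<otimes> I\<close>.\<close>

definition hopf_ideal ::
    "('k::field \<Rightarrow> 'h::ring_1 \<Rightarrow> 'h) \<Rightarrow> ('h \<Rightarrow> ('h \<times> 'h \<Rightarrow>\<^sub>0 'k)) \<Rightarrow> ('h \<Rightarrow> 'k) \<Rightarrow> ('h \<Rightarrow> 'h) \<Rightarrow>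
     'h set \<Rightarrow> bool" where
  "hopf_ideal scale \<Delta> \<epsilon> S I \<longleftrightarrow>
     two_sided_ideal I \<and>
     (\<forall>h\<in>I. \<exists>t. tensor2_eq scale (\<Delta> h) t \<and> Poly_Mapping.keys t \<subseteq> I \<times> UNIV \<union> UNIV \<times> I) \<and>
     (\<forall>h\<in>I. \<epsilon> h = 0) \<and>
     (\<forall>h\<in>I. S h \<in> I)"

definition module_algebra ::
    "('k::field \<Rightarrow> 'h::ring_1 \<Rightarrow> 'h) \<Rightarrow> ('h \<Rightarrow> ('h \<times> 'h \<Rightarrow>\<^sub>0 'k)) \<Rightarrow> ('h \<Rightarrow> 'k) \<Rightarrow>
     ('k \<Rightarrow> 'a::ring_1 \<Rightarrow> 'a) \<Rightarrow> ('h \<Rightarrow> 'a \<Rightarrow> 'a) \<Rightarrow> bool" where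
  "module_algebra scaleH \<Delta> \<epsilon> scaleA act \<longleftrightarrow>
     (\<forall>a. Vector_Spaces.linear scaleH scaleA (\<lambda>h. act h a)) \<and>
     (\<forall>h. Vector_Spaces.linear scaleA scaleA (act h)) \<and>
     (\<forall>a. act 1 a = a) \<and>
     (\<forall>h h' a. act (h * h') a = act h (act h' a)) \<and>
     (\<forall>h. act h 1 = scaleA (\<epsilon> h) 1) \<and>
     (\<forall>h a a'. act h (a * a') = lin_ext scaleA (\<lambda>(h1, h2). act h1 a * act h2 a') (\<Delta> h))"

definition inner_faithful ::
    "('k::field \<Rightarrow> 'h::ring_1 \<Rightarrow> 'h) \<Rightarrow> ('h \<Rightarrow> ('h \<times> 'h \<Rightarrow>\<^sub>0 'k)) \<Rightarrow> ('h \<Rightarrow> 'k) \<Rightarrow> ('h \<Rightarrow> 'h) \<Rightarrow>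
     ('h \<Rightarrow> 'a::ring_1 \<Rightarrow> 'a) \<Rightarrow> bool" where
  "inner_faithful scaleH \<Delta> \<epsilon> S act \<longleftrightarrow>
     \<not> (\<exists>I. hopf_ideal scaleH \<Delta> \<epsilon> S I \<and> I \<noteq> {0} \<and> (\<forall>h\<in>I. \<forall>a. act h a = 0))"

text \<open>The Hopf algebra with structure maps \<open>\<Delta>\<close>, \<open>\<epsilon>\<close>, \<open>S\<close> is \<open>T\<^sub>n(\<lambda>, m, 0)\<close>, with generators
  \<open>g\<close> and \<open>x\<close>. Since \<open>\<Delta>\<close> is an algebra homomorphism, its values on the generators determine
  it, and with it \<open>\<epsilon>\<close> and \<open>S\<close>.\<close>

definition generalized_taft ::
    "nat \<Rightarrow> 'k::field \<Rightarrow> nat \<Rightarrow>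
     ('k \<Rightarrow> 'h::ring_1 \<Rightarrow> 'h) \<Rightarrow> ('h \<Rightarrow> ('h \<times> 'h \<Rightarrow>\<^sub>0 'k)) \<Rightarrow> ('h \<Rightarrow> 'k) \<Rightarrow> ('h \<Rightarrow> 'h) \<Rightarrow>
     'h \<Rightarrow> 'h \<Rightarrow> bool" where
  "generalized_taft n lam m scale \<Delta> \<epsilon> S g x \<longleftrightarrow>
     (let G = free_gen Gen1; X = free_gen Gen2 in
      presented_by scale (case_gen g x) {G ^ n - 1, X ^ m, G * X - fscale lam (X * G)}) \<and>
     hopf_algebra scale \<Delta> \<epsilon> S \<and>
     tensor2_eq scale (\<Delta> g) (basis_vec (g, g)) \<and>
     tensor2_eq scale (\<Delta> x) (basis_vec (g, x) + basis_vec (x, 1))"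

definition linear_action ::
    "('k::field \<Rightarrow> 'a::ring_1 \<Rightarrow> 'a) \<Rightarrow> 'a \<Rightarrow> 'a \<Rightarrow> 'h \<Rightarrow> 'h \<Rightarrow> ('h \<Rightarrow> 'a \<Rightarrow> 'a) \<Rightarrow> bool" where
  "linear_action scaleA u v g x act \<longleftrightarrow>
     act g ` module.span scaleA {u, v} \<subseteq> module.span scaleA {u, v} \<and>
     act x ` module.span scaleA {u, v} \<subseteq> module.span scaleA {u, v}"

text \<open>The actions in the two cases of the classification, with \<open>lam\<close> the root of unity
  \<open>\<lambda>\<close> of the Taft algebra.\<close>

definition action_a ::
    "'k::field \<Rightarrow> 'k \<Rightarrow> 'k \<Rightarrow> ('k \<Rightarrow> 'a::ring_1 \<Rightarrow> 'a) \<Rightarrow> 'a \<Rightarrow> 'a \<Rightarrow> 'h \<Rightarrow> 'h \<Rightarrow>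
     ('h \<Rightarrow> 'a \<Rightarrow> 'a) \<Rightarrow> bool" where
  "action_a \<mu> lam \<eta> scaleA u v g x act \<longleftrightarrow>
     act g u = scaleA \<mu> u \<and> act g v = scaleA (inverse lam * \<mu>) v \<and>
     act x u = 0 \<and> act x v = scaleA \<eta> u"

definition action_b ::
    "'k::field \<Rightarrow> 'k \<Rightarrow> 'k \<Rightarrow> ('k \<Rightarrow> 'a::ring_1 \<Rightarrow> 'a) \<Rightarrow> 'a \<Rightarrow> 'a \<Rightarrow> 'h \<Rightarrow> 'h \<Rightarrow>
     ('h \<Rightarrow> 'a \<Rightarrow> 'a) \<Rightarrow> bool" where
  "action_b \<mu> lam \<eta> scaleA u v g x act \<longleftrightarrow>
     act g u = scaleA (inverse lam * inverse \<mu>) u \<and> act g v = scaleA (inverse \<mu>) v \<and>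
     act x u = scaleA \<eta> v \<and> act x v = 0"

end

theory Submission
  imports Defs "HOL-Library.Product_Plus"
begin

text \<open>
  Let \<open>V\<close> be the span of \<open>u\<close> and \<open>v\<close>, and write both algebras as \<open>u v = \<mu> v u + e\<close> with \<open>e = 0\<close> or
  \<open>e = 1\<close>. An action of \<open>T\<close> is an automorphism \<open>g\<close> of \<open>A\<close> together with a skew derivation \<open>x\<close>. If it is
  linear, it is given by two \<open>2 \<times> 2\<close> matrices, and comparing coefficients in the images of the
  defining relation, in \<open>g x = \<lambda> x g\<close> and in \<open>x\<^sup>m = 0\<close> leaves only the shapes (a), (b) and those in
  which \<open>x\<close> acts by zero (\<open>linear_inner_faithful_cases\<close>). Inner faithfulness excludes the latter,
  since \<open>x\<close> generates a nonzero Hopf ideal. In (a) and (b) the operator \<open>g\<close> has order \<open>lcm k m\<close>, so this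
  number divides \<open>n\<close>. It is not smaller than \<open>n\<close>, since \<open>g\<^sup>l - 1\<close> generates a nonzero Hopf ideal for
  \<open>0 < l < n\<close>, which would annihilate \<open>A\<close> if \<open>l\<close> were this order. That \<open>x\<close> and \<open>g\<^sup>l - 1\<close> are nonzero in the presented algebra \<open>T\<close> is shown in explicit
  representations.

  For the converse, \<open>V\<close> is in both cases a triangular \<open>T\<close>-module whose matrix coefficients
  separate enough of \<open>T\<close>: a Hopf ideal annihilating \<open>A\<close> is stable under the operators
  \<open>h \<mapsto> f(h\<^sub>2) h\<^sub>1\<close> for each matrix coefficient \<open>f\<close> of \<open>V\<close>, and these turn any nonzero element of the
  ideal into \<open>1\<close> (\<open>inner_faithful_triangular\<close>). The argument concerns \<open>V\<close> only and therefore covers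
  the quantum plane and the Weyl algebra together.

  To construct the actions, the automorphism and the skew derivation are read off from an algebra
  homomorphism from \<open>A\<close> to upper triangular matrices over \<open>A\<close>, which exists by the presentation of \<open>A\<close>.
  The relations of \<open>T\<close> then hold for these two operators because they can be checked along products of
  generators (\<open>triangular_action_exists\<close>). Case (b) is case (a) with \<open>u\<close> and \<open>v\<close> exchanged, both in
  this construction and for inner faithfulness.
\<close>

section \<open>Linear extension\<close>

lemma formal_induct [case_names basis add]:
  fixes t :: "'p \<Rightarrow>\<^sub>0 'k::field"
  assumes basis: "\<And>c p. P (fscale c (basis_vec p))"
    and add: "\<And>s t. P s \<Longrightarrow> P t \<Longrightarrow> P (s + t)"
  shows "P t"
proof (induction t rule: update_induct)
  case const
  have "fscale 0 (basis_vec (undefined :: 'p)) = (0 :: 'p \<Rightarrow>\<^sub>0 'k)" by simp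
  then show ?case using basis[of 0 undefined] by simp
next
  case (update t a b)
  have "Poly_Mapping.update a b t = t + fscale b (basis_vec a)"
    using update(1)
    by (auto simp: poly_mapping_eq_iff fun_eq_iff lookup_add lookup_update basis_vec_def
        lookup_single in_keys_iff when_def)
  then show ?case using add[OF update(3) basis] by simp
qed

context vector_space
begin

lemma lin_ext_superset:
  assumes "finite B" "Poly_Mapping.keys t \<subseteq> B"
  shows "lin_ext scale f t = (\<Sum>p\<in>B. scale (Poly_Mapping.lookup t p) (f p))"
  unfolding lin_ext_def by (rule sum.mono_neutral_left) (auto simp: assms in_keys_iff)

lemma lin_ext_add [simp]: "lin_ext scale f (s + t) = lin_ext scale f s + lin_ext scale f t"
proof -
  let ?B = "Poly_Mapping.keys s \<union> Poly_Mapping.keys t"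
  have "lin_ext scale f (s + t) = (\<Sum>p\<in>?B. scale (Poly_Mapping.lookup (s + t) p) (f p))"
    by (rule lin_ext_superset) (use keys_add[of s t] in auto)
  also have "\<dots> = (\<Sum>p\<in>?B. scale (Poly_Mapping.lookup s p) (f p)) +
      (\<Sum>p\<in>?B. scale (Poly_Mapping.lookup t p) (f p))"
    by (simp add: lookup_add scale_left_distrib sum.distrib)
  also have "\<dots> = lin_ext scale f s + lin_ext scale f t"
    by (simp add: lin_ext_superset[of ?B])
  finally show ?thesis .
qed

lemma lin_ext_fscale [simp]: "lin_ext scale f (fscale c t) = scale c (lin_ext scale f t)"
proof -
  have "lin_ext scale f (fscale c t) =
      (\<Sum>p\<in>Poly_Mapping.keys t. scale (Poly_Mapping.lookup (fscale c t) p) (f p))"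
    by (rule lin_ext_superset) (auto simp: in_keys_iff)
  then show ?thesis by (simp add: lin_ext_def scale_sum_right)
qed

lemma lin_ext_basis_vec [simp]: "lin_ext scale f (basis_vec p) = f p"
  by (simp add: lin_ext_def basis_vec_def)

lemma linear_lin_ext: "Vector_Spaces.linear fscale scale (lin_ext scale f)"
  by (simp add: Vector_Spaces.linear_iff vector_space_axioms formal.vector_space_axioms)

lemma lin_ext_zero [simp]: "lin_ext scale f 0 = 0"
  by (simp add: lin_ext_def)

lemma lin_ext_diff [simp]: "lin_ext scale f (s - t) = lin_ext scale f s - lin_ext scale f t"
  using lin_ext_add[of f "s - t" t] by simp

lemma lin_ext_comp:
  assumes "Vector_Spaces.linear scale scale' L"
  shows "L (lin_ext scale f t) = lin_ext scale' (\<lambda>p. L (f p)) t"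
proof -
  interpret L: Vector_Spaces.linear scale scale' L by fact
  show ?thesis by (simp add: lin_ext_def L.sum L.scale)
qed

lemma lin_ext_fun_add: "lin_ext scale (\<lambda>p. f p + h p) t = lin_ext scale f t + lin_ext scale h t"
  by (simp add: lin_ext_def scale_right_distrib sum.distrib)

lemma lin_ext_fun_scale: "lin_ext scale (\<lambda>p. scale c (f p)) t = scale c (lin_ext scale f t)"
  by (simp add: lin_ext_def scale_sum_right mult.commute)

end

lemma vector_space_field: "vector_space ((*) :: 'k::field \<Rightarrow> 'k \<Rightarrow> 'k)"
  by unfold_locales (auto simp: algebra_simps)

lemma lin_ext_swap:
  assumes "vector_space scale"
  shows "lin_ext scale (\<lambda>p. lin_ext scale (\<lambda>q. f p q) t) s = lin_ext scale (\<lambda>q. lin_ext scale (\<lambda>p. f p q) s) t"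
proof -
  interpret vector_space scale by fact
  show ?thesis
    unfolding lin_ext_def scale_sum_right scale_scale
    by (subst sum.swap) (simp add: mult.commute)
qed

definition pair_scale :: "('k \<Rightarrow> 'a \<Rightarrow> 'a) \<Rightarrow> 'k \<Rightarrow> 'a \<times> 'a \<Rightarrow> 'a \<times> 'a" where
  "pair_scale scale c w = (scale c (fst w), scale c (snd w))"

lemma (in vector_space) vector_space_pair_scale: "vector_space (pair_scale scale)"
  by unfold_locales
    (simp_all add: pair_scale_def scale_right_distrib scale_left_distrib prod_eq_iff plus_prod_def)

section \<open>Representations of free algebras\<close>

text \<open>The module over the free algebra in which the generator \<open>i\<close> acts as \<open>E i\<close>. Operators are used in place
  of an endomorphism algebra because the linear endomorphisms for a given scalar multiplication do not
  form a type.\<close>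

definition free_act ::
    "('k::field \<Rightarrow> 'w::ab_group_add \<Rightarrow> 'w) \<Rightarrow> ('x \<Rightarrow> 'w \<Rightarrow> 'w) \<Rightarrow> ('x word \<Rightarrow>\<^sub>0 'k) \<Rightarrow> 'w \<Rightarrow> 'w" where
  "free_act scale E f w = lin_ext scale (\<lambda>p. foldr E (letters p) w) f"

lemma basis_vec_mult: "basis_vec p * basis_vec q = basis_vec (p + q)"
  for p q :: "'x word"
  by (simp add: basis_vec_def mult_single)

lemma one_word: "(1 :: 'x word \<Rightarrow>\<^sub>0 'k::field) = basis_vec (Word [])"
  by (simp add: basis_vec_def zero_word_def[symmetric])

lemma fscale_mult:
  fixes s t :: "'x word \<Rightarrow>\<^sub>0 'k::field"
  shows "fscale c s * t = fscale c (s * t)" "s * fscale c t = fscale c (s * t)"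
proof -
  have eq: "fscale c r = Poly_Mapping.single 0 c * r" for r :: "'x word \<Rightarrow>\<^sub>0 'k"
  proof (induction r rule: formal_induct)
    case (basis d p)
    have "fscale d (basis_vec p) = Poly_Mapping.single p d"
      by (simp add: poly_mapping_eq_iff fun_eq_iff basis_vec_def lookup_single when_def)
    moreover have "fscale c (Poly_Mapping.single p d) = Poly_Mapping.single p (c * d)"
      by (simp add: poly_mapping_eq_iff fun_eq_iff lookup_single when_def)
    ultimately show ?case by (simp add: mult_single)
  qed (simp add: formal.scale_right_distrib distrib_left)
  have eq': "fscale c r = r * Poly_Mapping.single 0 c" for r :: "'x word \<Rightarrow>\<^sub>0 'k"
  proof (induction r rule: formal_induct)
    case (basis d p)
    have "fscale d (basis_vec p) = Poly_Mapping.single p d"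
      by (simp add: poly_mapping_eq_iff fun_eq_iff basis_vec_def lookup_single when_def)
    moreover have "fscale c (Poly_Mapping.single p d) = Poly_Mapping.single p (d * c)"
      by (simp add: poly_mapping_eq_iff fun_eq_iff lookup_single when_def)
    ultimately show ?case by (simp add: mult_single)
  qed (simp add: formal.scale_right_distrib distrib_right)
  show "fscale c s * t = fscale c (s * t)" by (simp add: eq mult.assoc)
  show "s * fscale c t = fscale c (s * t)" by (simp add: eq' mult.assoc)
qed

context vector_space
begin

lemma free_act_one [simp]: "free_act scale E 1 w = w"
  by (simp add: free_act_def one_word)

lemma free_act_gen [simp]: "free_act scale E (free_gen i) w = E i w"
  by (simp add: free_act_def free_gen_def)

lemma free_act_add [simp]: "free_act scale E (s + t) w = free_act scale E s w + free_act scale E t w"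
  by (simp add: free_act_def)

lemma free_act_diff [simp]: "free_act scale E (s - t) w = free_act scale E s w - free_act scale E t w"
  by (simp add: free_act_def)

lemma free_act_fscale [simp]: "free_act scale E (fscale c s) w = scale c (free_act scale E s w)"
  by (simp add: free_act_def)

lemma linear_free_act:
  assumes E: "\<And>i. Vector_Spaces.linear scale scale (E i)"
  shows "Vector_Spaces.linear scale scale (free_act scale E f)"
proof -
  have add: "foldr E l (w + w') = foldr E l w + foldr E l w'" for l w w'
    by (induction l) (use E in \<open>simp_all add: Vector_Spaces.linear_iff\<close>)
  have sc: "foldr E l (scale c w) = scale c (foldr E l w)" for l c w
    by (induction l) (use E in \<open>simp_all add: Vector_Spaces.linear_iff\<close>)
  show ?thesis
    by (simp add: Vector_Spaces.linear_iff vector_space_axioms free_act_def add sc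
        lin_ext_fun_add lin_ext_fun_scale)
qed

lemma free_act_mult [simp]:
  assumes E: "\<And>i. Vector_Spaces.linear scale scale (E i)"
  shows "free_act scale E (s * t) w = free_act scale E s (free_act scale E t w)"
proof (induction s rule: formal_induct)
  case (add s s')
  then show ?case by (simp add: distrib_right)
next
  case (basis c p)
  have "free_act scale E (basis_vec p * t) w = foldr E (letters p) (free_act scale E t w)"
  proof (induction t rule: formal_induct)
    case (basis d q)
    interpret Vector_Spaces.linear scale scale "free_act scale E (basis_vec p)"
      by (rule linear_free_act) (rule E)
    have "foldr E (letters p) (scale d w') = scale d (foldr E (letters p) w')" for w'
      using scale[of d w'] by (simp add: free_act_def)
    then show ?case
      by (simp add: fscale_mult basis_vec_mult) (simp add: free_act_def plus_word_def)
  next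
    case (add t t')
    note IH = add
    interpret Vector_Spaces.linear scale scale "free_act scale E (basis_vec p)"
      by (rule linear_free_act) (rule E)
    have "foldr E (letters p) (w + w') = foldr E (letters p) w + foldr E (letters p) w'" for w w'
      using local.add[of w w'] by (simp add: free_act_def)
    then show ?case by (simp add: distrib_left IH)
  qed
  then show ?case by (simp add: fscale_mult) (simp add: free_act_def)
qed

lemma free_act_power:
  assumes E: "\<And>i. Vector_Spaces.linear scale scale (E i)"
  shows "free_act scale E (f ^ j) w = (free_act scale E f ^^ j) w"
  by (induction j) (simp_all add: E)

end

context k_algebra
begin

lemma linear_mult_left: "Vector_Spaces.linear scale scale ((*) a)"
  by (simp add: Vector_Spaces.linear_iff vector_space_axioms distrib_left scale_mult_right)

lemma linear_mult_right: "Vector_Spaces.linear scale scale (\<lambda>b. b * a)"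
  by (simp add: Vector_Spaces.linear_iff vector_space_axioms distrib_right scale_mult_left)

lemma free_eval_free_act: "free_eval scale e f * b = free_act scale (\<lambda>i. (*) (e i)) f b"
proof -
  have *: "prod_list (map e l) * b = foldr (\<lambda>i. (*) (e i)) l b" for l
    by (induction l) (simp_all add: mult.assoc)
  show ?thesis
    by (simp add: free_eval_def free_act_def lin_ext_comp[OF linear_mult_right] *)
qed

lemma free_eval_mult [simp]: "free_eval scale e (s * t) = free_eval scale e s * free_eval scale e t"
  using free_eval_free_act[of e "s * t" 1] free_eval_free_act[of e t 1] free_eval_free_act[of e s]
  by (simp add: linear_mult_left)

lemma free_eval_one [simp]: "free_eval scale e 1 = 1"
  using free_eval_free_act[of e 1 1] by simp

lemma free_eval_gen [simp]: "free_eval scale e (free_gen i) = e i"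
  using free_eval_free_act[of e "free_gen i" 1] by simp

lemma free_eval_simps [simp]:
  "free_eval scale e (s + t) = free_eval scale e s + free_eval scale e t"
  "free_eval scale e (s - t) = free_eval scale e s - free_eval scale e t"
  "free_eval scale e (fscale c t) = scale c (free_eval scale e t)"
  by (simp_all add: free_eval_def)

lemma free_eval_power [simp]: "free_eval scale e (s ^ j) = free_eval scale e s ^ j"
  by (induction j) simp_all

end

section \<open>Presented algebras\<close>

lemma ideal_generated_ideal: "two_sided_ideal (ideal_generated R)"
  by (auto simp: ideal_generated_def two_sided_ideal_def)

lemma ideal_generated_superset: "R \<subseteq> ideal_generated R"
  by (auto simp: ideal_generated_def)

lemma ideal_generated_least: "two_sided_ideal I \<Longrightarrow> R \<subseteq> I \<Longrightarrow> ideal_generated R \<subseteq> I"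
  by (auto simp: ideal_generated_def)

lemma presented_relation:
  assumes "presented_by scale e R" "r \<in> R"
  shows "free_eval scale e r = 0"
  using assms ideal_generated_superset[of R] by (auto simp: presented_by_def)

lemma presented_induct [consumes 1, case_names one gen add scale]:
  assumes P: "presented_by scale e R"
    and one: "Q 1" and gen: "\<And>i a. Q a \<Longrightarrow> Q (e i * a)"
    and add: "\<And>a b. Q a \<Longrightarrow> Q b \<Longrightarrow> Q (a + b)" and sc: "\<And>c a. Q a \<Longrightarrow> Q (scale c a)"
  shows "Q a"
proof -
  interpret k_algebra scale using P by (simp add: presented_by_def)
  obtain f where f: "a = free_eval scale e f"
    using P unfolding presented_by_def by (metis surjD)
  show ?thesis unfolding f
  proof (induction f rule: formal_induct)
    case (basis c p)
    have "Q (prod_list (map e l))" for l by (induction l) (simp_all add: one gen)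
    then show ?case by (simp add: free_eval_def sc)
  qed (simp add: add)
qed

text \<open>The universal property: a representation of the free algebra that kills the relations kills the ideal
  which they generate, so it factors through the presented algebra.\<close>

lemma presented_rep:
  assumes P: "presented_by scale e R" and W: "vector_space scaleW"
    and E: "\<And>i. Vector_Spaces.linear scaleW scaleW (E i)"
    and R: "\<And>r w. r \<in> R \<Longrightarrow> free_act scaleW E r w = 0"
  obtains \<rho> where "\<And>w. Vector_Spaces.linear scale scaleW (\<lambda>a. \<rho> a w)"
    "\<And>a. Vector_Spaces.linear scaleW scaleW (\<rho> a)"
    "\<And>w. \<rho> 1 w = w" "\<And>a b w. \<rho> (a * b) w = \<rho> a (\<rho> b w)" "\<And>i w. \<rho> (e i) w = E i w"
proof -
  interpret k_algebra scale using P by (simp add: presented_by_def)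
  interpret W: vector_space scaleW by fact
  let ?K = "{f. \<forall>w. free_act scaleW E f w = 0}"
  have zero: "free_act scaleW E f 0 = 0" for f
  proof -
    interpret Vector_Spaces.linear scaleW scaleW "free_act scaleW E f"
      by (rule W.linear_free_act) (rule E)
    show ?thesis by (rule zero)
  qed
  have "two_sided_ideal ?K"
    by (auto simp: two_sided_ideal_def E zero) (simp add: free_act_def)
  then have K: "ideal_generated R \<subseteq> ?K"
    by (rule ideal_generated_least) (auto simp: R)
  have wd: "free_act scaleW E f w = free_act scaleW E f' w"
    if "free_eval scale e f = free_eval scale e f'" for f f' w
  proof -
    have "f - f' \<in> ideal_generated R"
      using that P by (auto simp: presented_by_def)
    then have "free_act scaleW E (f - f') w = 0" using K by blast
    then show ?thesis by simp
  qed
  define \<rho> where "\<rho> a = free_act scaleW E (SOME f. free_eval scale e f = a)" for a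
  have \<rho>: "\<rho> (free_eval scale e f) w = free_act scaleW E f w" for f w
    unfolding \<rho>_def by (rule wd) (rule someI[of _ f], simp)
  have surj: "\<exists>f. a = free_eval scale e f" for a
    using P unfolding presented_by_def by (metis surjD)
  show thesis
  proof (rule that[of \<rho>])
    show "Vector_Spaces.linear scale scaleW (\<lambda>a. \<rho> a w)" for w
      unfolding Vector_Spaces.linear_iff
    proof (intro conjI allI)
      show "\<rho> (a + b) w = \<rho> a w + \<rho> b w" for a b
        using surj[of a] surj[of b]
        by (metis \<rho> W.free_act_add free_eval_simps(1))
      show "\<rho> (scale c a) w = scaleW c (\<rho> a w)" for c a
        using surj[of a] by (metis \<rho> W.free_act_fscale free_eval_simps(3))
    qed unfold_locales
    show "Vector_Spaces.linear scaleW scaleW (\<rho> a)" for a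
      unfolding \<rho>_def by (rule W.linear_free_act) (rule E)
    show "\<rho> 1 w = w" for w using \<rho>[of 1 w] by simp
    show "\<rho> (a * b) w = \<rho> a (\<rho> b w)" for a b w
      using surj[of a] surj[of b] by (metis \<rho> W.free_act_mult E free_eval_mult)
    show "\<rho> (e i) w = E i w" for i w using \<rho>[of "free_gen i" w] by simp
  qed
qed

section \<open>Tensors and multilinear maps\<close>

definition bilinear_pair ::
    "('k::field \<Rightarrow> 'h::ab_group_add \<Rightarrow> 'h) \<Rightarrow> ('k \<Rightarrow> 'w::ab_group_add \<Rightarrow> 'w) \<Rightarrow> ('h \<times> 'h \<Rightarrow> 'w) \<Rightarrow> bool" where
  "bilinear_pair scale scaleW B \<longleftrightarrow>
     (\<forall>b. Vector_Spaces.linear scale scaleW (\<lambda>a. B (a, b))) \<and>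
     (\<forall>a. Vector_Spaces.linear scale scaleW (\<lambda>b. B (a, b)))"

lemma lin_ext_span_eq_0:
  assumes W: "vector_space scaleW" and z: "z \<in> formal.span X"
    and X: "\<And>r. r \<in> X \<Longrightarrow> lin_ext scaleW B r = 0"
  shows "lin_ext scaleW B z = 0"
proof -
  interpret W: vector_space scaleW by fact
  show ?thesis using z
    by (rule formal.span_induct) (auto simp: X formal.subspace_def)
qed

lemma slot_relations_intros:
  "basis_vec (j (a + b)) - basis_vec (j a) - basis_vec (j b) \<in> slot_relations scale j"
  "basis_vec (j (scale c a)) - fscale c (basis_vec (j a)) \<in> slot_relations scale j"
  unfolding slot_relations_def by blast+

lemma slot_relations_cases:
  assumes "r \<in> slot_relations scale j"
  obtains a b where "r = basis_vec (j (a + b)) - basis_vec (j a) - basis_vec (j b)"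
  | c a where "r = basis_vec (j (scale c a)) - fscale c (basis_vec (j a))"
  using assms unfolding slot_relations_def by blast

lemma lin_ext_slot_relations:
  assumes "Vector_Spaces.linear scale scaleW (\<lambda>h. B (j h))" "r \<in> slot_relations scale j"
  shows "lin_ext scaleW B r = 0"
proof -
  interpret W: vector_space scaleW using assms(1) by (simp add: Vector_Spaces.linear_iff)
  show ?thesis using assms(2,1) by (auto simp: slot_relations_def Vector_Spaces.linear_iff)
qed

text \<open>A bilinear map factors through the tensor product, so it may be evaluated on any representative of
  a coproduct.\<close>

lemma tensor2_eq_lin_ext:
  assumes eq: "tensor2_eq scale s t" and B: "bilinear_pair scale scaleW B"
  shows "lin_ext scaleW B s = lin_ext scaleW B t"
proof -
  interpret W: vector_space scaleW
    using B by (auto simp: bilinear_pair_def Vector_Spaces.linear_iff)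
  have "lin_ext scaleW B (s - t) = 0"
    by (rule lin_ext_span_eq_0[OF W.vector_space_axioms eq[unfolded tensor2_eq_def]])
       (use B in \<open>auto simp: bilinear_pair_def intro: lin_ext_slot_relations\<close>)
  then show ?thesis by simp
qed

lemma tensor3_eq_lin_ext:
  assumes eq: "tensor3_eq scale s t"
    and B: "\<And>b c. Vector_Spaces.linear scale scaleW (\<lambda>h. B (h, b, c))"
      "\<And>a c. Vector_Spaces.linear scale scaleW (\<lambda>h. B (a, h, c))"
      "\<And>a b. Vector_Spaces.linear scale scaleW (\<lambda>h. B (a, b, h))"
  shows "lin_ext scaleW B s = lin_ext scaleW B t"
proof -
  interpret W: vector_space scaleW
    using B(1) by (auto simp: Vector_Spaces.linear_iff)
  have "lin_ext scaleW B (s - t) = 0"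
    by (rule lin_ext_span_eq_0[OF W.vector_space_axioms eq[unfolded tensor3_eq_def]])
       (auto dest: lin_ext_slot_relations[where j = "\<lambda>h. (h, b, c)" and B = B for b c, OF B(1)]
          lin_ext_slot_relations[where j = "\<lambda>h. (a, h, c)" and B = B for a c, OF B(2)]
          lin_ext_slot_relations[where j = "\<lambda>h. (a, b, h)" and B = B for a b, OF B(3)])
  then show ?thesis by simp
qed

lemma tensor2_eq_refl [simp]: "tensor2_eq scale s s"
  by (simp add: tensor2_eq_def formal.span_zero)

lemma tensor2_eq_sym: "tensor2_eq scale s t \<Longrightarrow> tensor2_eq scale t s"
  unfolding tensor2_eq_def using formal.span_neg[of "s - t"] by simp

lemma tensor2_eq_trans [trans]: "tensor2_eq scale s t \<Longrightarrow> tensor2_eq scale t r \<Longrightarrow> tensor2_eq scale s r"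
  unfolding tensor2_eq_def using formal.span_add[of "s - t" _ "t - r"] by simp

lemma tensor2_eq_add:
  "tensor2_eq scale s t \<Longrightarrow> tensor2_eq scale s' t' \<Longrightarrow> tensor2_eq scale (s + s') (t + t')"
  unfolding tensor2_eq_def using formal.span_add[of "s - t" _ "s' - t'"] by (simp add: algebra_simps)

lemma tensor2_eq_slot1:
  assumes "r \<in> slot_relations scale (\<lambda>h. (h, b))" "r = s - t"
  shows "tensor2_eq scale s t"
  using assms unfolding tensor2_eq_def by (auto intro!: formal.span_base)

lemma tensor2_eq_slot2:
  assumes "r \<in> slot_relations scale (\<lambda>h. (a, h))" "r = s - t"
  shows "tensor2_eq scale s t"
  using assms unfolding tensor2_eq_def by (auto intro!: formal.span_base)

lemma tensor2_eq_diff1: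
  "tensor2_eq scale (basis_vec (a - b, c)) (basis_vec (a, c) - basis_vec (b, c))"
proof (rule tensor2_eq_sym[OF tensor2_eq_slot1])
  show "basis_vec ((a - b) + b, c) - basis_vec (a - b, c) - basis_vec (b, c) \<in> slot_relations scale (\<lambda>h. (h, c))"
    unfolding slot_relations_def by blast
qed simp

lemma tensor2_eq_diff2:
  "tensor2_eq scale (basis_vec (c, a - b)) (basis_vec (c, a) - basis_vec (c, b))"
proof (rule tensor2_eq_sym[OF tensor2_eq_slot2])
  show "basis_vec (c, (a - b) + b) - basis_vec (c, a - b) - basis_vec (c, b) \<in> slot_relations scale (\<lambda>h. (c, h))"
    unfolding slot_relations_def by blast
qed simp

lemma keys_basis_vec: "Poly_Mapping.keys (basis_vec p) \<subseteq> {p}"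
  by (simp add: basis_vec_def)

lemma keys_lin_ext: "Poly_Mapping.keys (lin_ext fscale f t) \<subseteq> (\<Union>p\<in>Poly_Mapping.keys t. Poly_Mapping.keys (f p))"
proof
  fix q assume "q \<in> Poly_Mapping.keys (lin_ext fscale f t)"
  then have "(\<Sum>p\<in>Poly_Mapping.keys t. Poly_Mapping.lookup t p * Poly_Mapping.lookup (f p) q) \<noteq> 0"
    by (simp add: in_keys_iff lin_ext_def lookup_sum)
  then obtain p where "p \<in> Poly_Mapping.keys t" "Poly_Mapping.lookup (f p) q \<noteq> 0"
    by (metis (no_types, lifting) mult_zero_right sum.neutral)
  then show "q \<in> (\<Union>p\<in>Poly_Mapping.keys t. Poly_Mapping.keys (f p))"
    by (auto simp: in_keys_iff)
qed

lemma keys_tensor_mult: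
  assumes "q \<in> Poly_Mapping.keys (tensor_mult s t)"
  obtains a b c d where "(a, b) \<in> Poly_Mapping.keys s" "(c, d) \<in> Poly_Mapping.keys t" "q = (a * c, b * d)"
proof -
  obtain a b where ab: "(a, b) \<in> Poly_Mapping.keys s"
    "q \<in> Poly_Mapping.keys (lin_ext fscale (\<lambda>(c, d). basis_vec (a * c, b * d)) t)"
    using assms keys_lin_ext unfolding tensor_mult_def by fast
  obtain c d where "(c, d) \<in> Poly_Mapping.keys t" "q \<in> Poly_Mapping.keys (basis_vec (a * c, b * d) :: _ \<Rightarrow>\<^sub>0 'b)"
    using ab(2) keys_lin_ext by fast
  then show thesis using ab(1) that keys_basis_vec by fast
qed

lemma lin_ext_tensor_mult:
  assumes "vector_space scaleW"
  shows "lin_ext scaleW B (tensor_mult s t) =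
    lin_ext scaleW (\<lambda>(a, b). lin_ext scaleW (\<lambda>(c, d). B (a * c, b * d)) t) s"
proof -
  interpret W: vector_space scaleW by fact
  show ?thesis
    by (simp add: tensor_mult_def formal.lin_ext_comp[OF W.linear_lin_ext] split_def)
qed

lemma tensor_mult_basis_vec [simp]: "tensor_mult (basis_vec (a, b)) (basis_vec (c, d)) = basis_vec (a * c, b * d)"
  by (simp add: tensor_mult_def)

lemma tensor_mult_add [simp]:
  "tensor_mult (s + s') t = tensor_mult s t + tensor_mult s' t"
  "tensor_mult s (t + t') = tensor_mult s t + tensor_mult s t'"
  by (simp_all add: tensor_mult_def split_def formal.lin_ext_fun_add)

lemma tensor_mult_diff:
  "tensor_mult (s - s') t = tensor_mult s t - tensor_mult s' t"
  "tensor_mult s (t - t') = tensor_mult s t - tensor_mult s t'"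
proof -
  show "tensor_mult (s - s') t = tensor_mult s t - tensor_mult s' t"
    using tensor_mult_add(1)[of "s - s'" s' t] by (simp del: tensor_mult_add)
  show "tensor_mult s (t - t') = tensor_mult s t - tensor_mult s t'"
    using tensor_mult_add(2)[of s "t - t'" t'] by (simp del: tensor_mult_add)
qed

lemma tensor_mult_zero [simp]: "tensor_mult 0 t = 0" "tensor_mult s 0 = 0"
  using tensor_mult_diff(1)[of 0 0 t] tensor_mult_diff(2)[of s 0 0] by simp_all

lemma tensor_mult_fscale:
  "tensor_mult (fscale c s) t = fscale c (tensor_mult s t)"
  "tensor_mult s (fscale c t) = fscale c (tensor_mult s t)"
  by (simp_all add: tensor_mult_def split_def formal.lin_ext_fun_scale)

context k_algebra
begin

lemma tensor_mult_slot_relation: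
  assumes "r \<in> (\<Union>b. slot_relations scale (\<lambda>h. (h, b))) \<union> (\<Union>a. slot_relations scale (\<lambda>h. (a, h)))"
  shows "tensor2_eq scale (tensor_mult s r) 0" "tensor2_eq scale (tensor_mult r s) 0"
proof -
  let ?R = "(\<Union>b. slot_relations scale (\<lambda>h. (h, b))) \<union> (\<Union>a. slot_relations scale (\<lambda>h. (a, h)))"
  have lr: "tensor_mult (basis_vec (c, d)) r \<in> ?R \<and> tensor_mult r (basis_vec (c, d)) \<in> ?R" for c d
  proof -
    note simps = tensor_mult_diff tensor_mult_fscale tensor_mult_basis_vec distrib_left distrib_right
        scale_mult_left[symmetric] scale_mult_right[symmetric]
    consider y where "r \<in> slot_relations scale (\<lambda>h. (h, y))" | y where "r \<in> slot_relations scale (\<lambda>h. (y, h))"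
      using assms by blast
    then show ?thesis
    proof cases
      case 1
      then have "tensor_mult (basis_vec (c, d)) r \<in> slot_relations scale (\<lambda>h. (h, d * y))"
        "tensor_mult r (basis_vec (c, d)) \<in> slot_relations scale (\<lambda>h. (h, y * d))"
        by (auto elim!: slot_relations_cases simp only: simps
             intro: slot_relations_intros[where j = "\<lambda>h. (h, b)" for b])
      then show ?thesis by blast
    next
      case 2
      then have "tensor_mult (basis_vec (c, d)) r \<in> slot_relations scale (\<lambda>h. (c * y, h))"
        "tensor_mult r (basis_vec (c, d)) \<in> slot_relations scale (\<lambda>h. (y * c, h))"
        by (auto elim!: slot_relations_cases simp only: simps
             intro: slot_relations_intros[where j = "\<lambda>h. (a, h)" for a])
      then show ?thesis by blast
    qed
  qed
  show "tensor2_eq scale (tensor_mult s r) 0"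
  proof (induction s rule: formal_induct)
    case (basis c p)
    show ?case
      using formal.span_scale[OF formal.span_base, of _ ?R c] lr[of "fst p" "snd p"]
      by (simp only: tensor2_eq_def tensor_mult_fscale diff_zero prod.collapse)
  next
    case (add s t) then show ?case using tensor2_eq_add[OF add] by simp
  qed
  show "tensor2_eq scale (tensor_mult r s) 0"
  proof (induction s rule: formal_induct)
    case (basis c p)
    show ?case
      using formal.span_scale[OF formal.span_base, of _ ?R c] lr[of "fst p" "snd p"]
      by (simp only: tensor2_eq_def tensor_mult_fscale diff_zero prod.collapse)
  next
    case (add s t) then show ?case using tensor2_eq_add[OF add] by simp
  qed
qed

lemma tensor_mult_cong:
  assumes "tensor2_eq scale t t'"
  shows "tensor2_eq scale (tensor_mult s t) (tensor_mult s t')"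
    and "tensor2_eq scale (tensor_mult t s) (tensor_mult t' s)"
proof -
  have "formal.subspace {r. tensor2_eq scale (tensor_mult s r) 0}"
    by (simp add: formal.subspace_def tensor_mult_fscale tensor2_eq_def
         formal.span_zero formal.span_add formal.span_scale)
  then have "tensor2_eq scale (tensor_mult s (t - t')) 0"
    using formal.span_minimal[of _ "{r. tensor2_eq scale (tensor_mult s r) 0}"] assms tensor_mult_slot_relation(1)
    unfolding tensor2_eq_def[of _ t t'] by blast
  then show "tensor2_eq scale (tensor_mult s t) (tensor_mult s t')"
    by (simp add: tensor_mult_diff tensor2_eq_def)
  have "formal.subspace {r. tensor2_eq scale (tensor_mult r s) 0}"
    by (simp add: formal.subspace_def tensor_mult_fscale tensor2_eq_def
         formal.span_zero formal.span_add formal.span_scale)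
  then have "tensor2_eq scale (tensor_mult (t - t') s) 0"
    using formal.span_minimal[of _ "{r. tensor2_eq scale (tensor_mult r s) 0}"] assms tensor_mult_slot_relation(2)
    unfolding tensor2_eq_def[of _ t t'] by blast
  then show "tensor2_eq scale (tensor_mult t s) (tensor_mult t' s)"
    by (simp add: tensor_mult_diff tensor2_eq_def)
qed

lemma two_sided_ideal_scale: "two_sided_ideal I \<Longrightarrow> a \<in> I \<Longrightarrow> scale c a \<in> I"
  using scale_mult_left[of c 1 a] by (metis mult_1 two_sided_ideal_def)

lemma two_sided_ideal_sum: "two_sided_ideal I \<Longrightarrow> (\<And>p. p \<in> B \<Longrightarrow> f p \<in> I) \<Longrightarrow> sum f B \<in> I"
  by (induction B rule: infinite_finite_induct) (auto simp: two_sided_ideal_def)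

end

section \<open>Hopf algebras\<close>

context hopf_algebra
begin

lemma comult_lin_ext:
  assumes B: "bilinear_pair scale scaleW B"
  shows "lin_ext scaleW B (\<Delta> (a + b)) = lin_ext scaleW B (\<Delta> a) + lin_ext scaleW B (\<Delta> b)"
    and "lin_ext scaleW B (\<Delta> (scale c a)) = scaleW c (lin_ext scaleW B (\<Delta> a))"
    and "lin_ext scaleW B (\<Delta> 1) = B (1, 1)"
    and "lin_ext scaleW B (\<Delta> (h * h')) =
      lin_ext scaleW (\<lambda>(a, b). lin_ext scaleW (\<lambda>(c, d). B (a * c, b * d)) (\<Delta> h')) (\<Delta> h)"
proof -
  interpret W: vector_space scaleW
    using B by (auto simp: bilinear_pair_def Vector_Spaces.linear_iff)
  show "lin_ext scaleW B (\<Delta> (a + b)) = lin_ext scaleW B (\<Delta> a) + lin_ext scaleW B (\<Delta> b)"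
    by (subst tensor2_eq_lin_ext[OF comult_add B]) simp
  show "lin_ext scaleW B (\<Delta> (scale c a)) = scaleW c (lin_ext scaleW B (\<Delta> a))"
    by (subst tensor2_eq_lin_ext[OF comult_scale B]) simp
  show "lin_ext scaleW B (\<Delta> 1) = B (1, 1)"
    by (subst tensor2_eq_lin_ext[OF comult_one B]) simp
  show "lin_ext scaleW B (\<Delta> (h * h')) =
      lin_ext scaleW (\<lambda>(a, b). lin_ext scaleW (\<lambda>(c, d). B (a * c, b * d)) (\<Delta> h')) (\<Delta> h)"
    by (subst tensor2_eq_lin_ext[OF comult_mult B]) (simp add: lin_ext_tensor_mult[OF W.vector_space_axioms])
qed

lemma linear_counit: "\<epsilon> (a + b) = \<epsilon> a + \<epsilon> b" "\<epsilon> (scale c a) = c * \<epsilon> a" "\<epsilon> (a - b) = \<epsilon> a - \<epsilon> b" "\<epsilon> 0 = 0"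
proof -
  interpret e: Vector_Spaces.linear scale "(*)" \<epsilon> by (rule counit_linear)
  show "\<epsilon> (a + b) = \<epsilon> a + \<epsilon> b" "\<epsilon> (scale c a) = c * \<epsilon> a" "\<epsilon> (a - b) = \<epsilon> a - \<epsilon> b" "\<epsilon> 0 = 0"
    by (rule e.add e.scale e.diff e.zero)+
qed

lemma linear_antipode: "S (a + b) = S a + S b" "S (scale c a) = scale c (S a)" "S (a - b) = S a - S b" "S 0 = 0"
proof -
  interpret e: Vector_Spaces.linear scale scale S by (rule antipode_linear)
  show "S (a + b) = S a + S b" "S (scale c a) = scale c (S a)" "S (a - b) = S a - S b" "S 0 = 0"
    by (rule e.add e.scale e.diff e.zero)+
qed

text \<open>In the convolution algebra, \<open>F * id = c \<epsilon>\<close> implies \<open>F = c S\<close>, because \<open>S\<close> is a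
  right inverse of \<open>id\<close>.\<close>

lemma left_convolution_inverse:
  assumes F: "Vector_Spaces.linear scale scale F"
    and inv: "\<And>h. lin_ext scale (\<lambda>(a, b). F a * b) (\<Delta> h) = scale (\<epsilon> h) c"
  shows "F h = c * S h"
proof -
  let ?B = "\<lambda>(a, b, c). F a * b * S c"
  have F': "F (a + b) = F a + F b" "F (scale d a) = scale d (F a)" for a b d
    using F by (simp_all add: Vector_Spaces.linear_iff)
  have lin: "Vector_Spaces.linear scale scale (\<lambda>h. ?B (h, b, c))"
    "Vector_Spaces.linear scale scale (\<lambda>h. ?B (b, h, c))"
    "Vector_Spaces.linear scale scale (\<lambda>h. ?B (b, c, h))" for b c
    by (simp_all add: Vector_Spaces.linear_iff vector_space_axioms F' distrib_left distrib_right
        scale_mult_left[symmetric] scale_mult_right[symmetric] linear_antipode)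
  have "lin_ext scale (\<lambda>(a, b). lin_ext scale (\<lambda>(a1, a2). F a1 * a2 * S b) (\<Delta> a)) (\<Delta> h) =
    lin_ext scale (\<lambda>(a, b). lin_ext scale (\<lambda>(b1, b2). F a * b1 * S b2) (\<Delta> b)) (\<Delta> h)"
    using tensor3_eq_lin_ext[OF coassoc lin, of h]
    by (simp add: formal.lin_ext_comp[OF linear_lin_ext] split_def)
  moreover have "lin_ext scale (\<lambda>(a1, a2). F a1 * a2 * S b) (\<Delta> a) = c * S (scale (\<epsilon> a) b)" for a b
    using lin_ext_comp[OF linear_mult_right[of "S b"], of "\<lambda>(a, b). F a * b" "\<Delta> a"] inv[of a]
    by (simp add: split_def scale_mult_left[symmetric] scale_mult_right[symmetric] linear_antipode)
  moreover have "lin_ext scale (\<lambda>(b1, b2). F a * b1 * S b2) (\<Delta> b) = F (scale (\<epsilon> b) a)" for a b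
    using lin_ext_comp[OF linear_mult_left[of "F a"], of "\<lambda>(a, b). a * S b" "\<Delta> b"] antipode_right[of b]
    by (simp add: split_def scale_mult_right[symmetric] F' mult.assoc)
  moreover have "lin_ext scale (\<lambda>(a, b). c * S (scale (\<epsilon> a) b)) (\<Delta> h) = c * S h"
    using lin_ext_comp[OF linear_mult_left[of c], of "\<lambda>(a, b). S (scale (\<epsilon> a) b)" "\<Delta> h"]
      lin_ext_comp[OF antipode_linear, of "\<lambda>(a, b). scale (\<epsilon> a) b" "\<Delta> h"] counit_left[of h]
    by (simp add: split_def)
  moreover have "lin_ext scale (\<lambda>(a, b). F (scale (\<epsilon> b) a)) (\<Delta> h) = F h"
    using lin_ext_comp[OF F, of "\<lambda>(a, b). scale (\<epsilon> b) a" "\<Delta> h"] counit_right[of h]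
    by (simp add: split_def)
  ultimately show ?thesis by simp
qed

text \<open>Each of the conditions on a Hopf ideal describes a two-sided ideal of elements \<open>h\<close>, because
  \<open>\<Delta>\<close> and \<open>\<epsilon>\<close> are multiplicative and \<open>S\<close> is antimultiplicative. So they need to be checked on the generator
  only.\<close>

lemma hopf_ideal_generated:
  assumes anti: "\<And>a b. S (a * b) = S b * S a"
    and \<Delta>z: "tensor2_eq scale (\<Delta> z) t"
    and t: "Poly_Mapping.keys t \<subseteq> ideal_generated {z} \<times> UNIV \<union> UNIV \<times> ideal_generated {z}"
    and \<epsilon>z: "\<epsilon> z = 0" and Sz: "S z \<in> ideal_generated {z}"
  shows "hopf_ideal scale \<Delta> \<epsilon> S (ideal_generated {z})"
proof -
  let ?I = "ideal_generated {z}"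
  let ?N = "?I \<times> UNIV \<union> UNIV \<times> ?I"
  have I: "two_sided_ideal ?I" by (rule ideal_generated_ideal)
  have mult: "Poly_Mapping.keys (tensor_mult r s) \<subseteq> ?N" "Poly_Mapping.keys (tensor_mult s r) \<subseteq> ?N"
    if "Poly_Mapping.keys s \<subseteq> ?N" for r s
    using that I by (auto elim!: keys_tensor_mult simp: two_sided_ideal_def)
  define K where "K h \<longleftrightarrow> (\<exists>t. tensor2_eq scale (\<Delta> h) t \<and> Poly_Mapping.keys t \<subseteq> ?N)" for h
  have "tensor2_eq scale (\<Delta> 0) 0" using comult_scale[of 0 0] by simp
  then have K0: "K 0" unfolding K_def by (intro exI[of _ 0]) simp
  have K_add: "K (a + b)" if ab: "K a" "K b" for a b
  proof -
    obtain s t where st: "tensor2_eq scale (\<Delta> a) s" "Poly_Mapping.keys s \<subseteq> ?N"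
      "tensor2_eq scale (\<Delta> b) t" "Poly_Mapping.keys t \<subseteq> ?N"
      using ab unfolding K_def by blast
    have "Poly_Mapping.keys (s + t) \<subseteq> ?N" using keys_add[of s t] st(2,4) by blast
    then show ?thesis
      using tensor2_eq_trans[OF comult_add tensor2_eq_add[OF st(1,3)]] unfolding K_def by blast
  qed
  have K_mult: "K (r * a)" "K (a * r)" if a: "K a" for a r
  proof -
    obtain s where s: "tensor2_eq scale (\<Delta> a) s" "Poly_Mapping.keys s \<subseteq> ?N"
      using a unfolding K_def by blast
    show "K (r * a)" unfolding K_def
      using tensor2_eq_trans[OF comult_mult tensor_mult_cong(1)[OF s(1)]] mult(1)[OF s(2)] by blast
    show "K (a * r)" unfolding K_def
      using tensor2_eq_trans[OF comult_mult tensor_mult_cong(2)[OF s(1)]] mult(2)[OF s(2)] by blast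
  qed
  have "two_sided_ideal {h. K h}"
    by (simp add: two_sided_ideal_def K0 K_add K_mult)
  then have 1: "?I \<subseteq> {h. K h}"
    by (rule ideal_generated_least) (use \<Delta>z t in \<open>auto simp: K_def\<close>)
  have "two_sided_ideal {h. \<epsilon> h = 0}"
    by (simp add: two_sided_ideal_def linear_counit counit_mult)
  then have 2: "?I \<subseteq> {h. \<epsilon> h = 0}" by (rule ideal_generated_least) (use \<epsilon>z in blast)
  have "two_sided_ideal {h. S h \<in> ?I}"
    using I by (simp add: two_sided_ideal_def linear_antipode anti)
  then have 3: "?I \<subseteq> {h. S h \<in> ?I}" by (rule ideal_generated_least) (use Sz in blast)
  show ?thesis using I 1 2 3 unfolding hopf_ideal_def K_def by blast
qed

text \<open>The usual left action of the dual algebra on a coalgebra, written \<open>f \<rightharpoonup> h\<close>.\<close>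

definition hit :: "('h \<Rightarrow> 'k) \<Rightarrow> 'h \<Rightarrow> 'h" where
  "hit f h = lin_ext scale (\<lambda>(a, b). scale (f b) a) (\<Delta> h)"

lemma bilinear_hit:
  "Vector_Spaces.linear scale (*) f \<Longrightarrow> bilinear_pair scale scale (\<lambda>(a, b). scale (f b) a)"
  by (simp add: bilinear_pair_def Vector_Spaces.linear_iff scale_right_distrib scale_left_distrib mult.commute)

lemma linear_hit:
  assumes "Vector_Spaces.linear scale (*) f"
  shows "Vector_Spaces.linear scale scale (hit f)"
  unfolding hit_def Vector_Spaces.linear_iff
  by (simp add: vector_space_axioms comult_lin_ext[OF bilinear_hit[OF assms]])

text \<open>The assumption says that \<open>p \<otimes> q + p' \<otimes> q'\<close> is the coproduct of \<open>f\<close> in the dual. Two summands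
  suffice for the coefficients of triangular \<open>2 \<times> 2\<close> representations: a diagonal coefficient gives an
  algebra endomorphism, an off-diagonal one a skew derivation.\<close>

lemma hit_mult:
  assumes f: "Vector_Spaces.linear scale (*) f"
    and mult: "\<And>h h'. f (h * h') = p h * q h' + p' h * q' h'"
  shows "hit f (h * h') = hit p h * hit q h' + hit p' h * hit q' h'"
proof -
  have *: "hit p h * hit q h' =
      lin_ext scale (\<lambda>(a, b). lin_ext scale (\<lambda>(c, d). scale (p b * q d) (a * c)) (\<Delta> h')) (\<Delta> h)" for p q
  proof -
    have "hit p h * hit q h' = lin_ext scale (\<lambda>(a, b). scale (p b) a * hit q h') (\<Delta> h)"
      unfolding hit_def[of p] by (simp add: lin_ext_comp[OF linear_mult_right] split_def)
    also have "\<dots> = lin_ext scale (\<lambda>(a, b). lin_ext scale (\<lambda>(c, d). scale (p b) a * scale (q d) c) (\<Delta> h')) (\<Delta> h)"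
      unfolding hit_def by (simp add: lin_ext_comp[OF linear_mult_left] split_def)
    finally show ?thesis
      by (simp add: scale_mult_left[symmetric] scale_mult_right[symmetric] mult.commute)
  qed
  show ?thesis
    unfolding * hit_def[of f] comult_lin_ext(4)[OF bilinear_hit[OF f]]
    by (simp add: mult scale_left_distrib lin_ext_fun_add split_def)
qed

lemma hit_tensor:
  assumes "Vector_Spaces.linear scale (*) f" "tensor2_eq scale (\<Delta> h) t"
  shows "hit f h = lin_ext scale (\<lambda>(a, b). scale (f b) a) t"
  unfolding hit_def by (rule tensor2_eq_lin_ext[OF assms(2) bilinear_hit[OF assms(1)]])

text \<open>In every summand of a coproduct in \<open>I \<otimes> H + H \<otimes> I\<close>, the first factor lies in \<open>I\<close> or the second one is killed
  by \<open>f\<close>.\<close>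

lemma hit_hopf_ideal:
  assumes I: "hopf_ideal scale \<Delta> \<epsilon> S I" and f: "Vector_Spaces.linear scale (*) f"
    and fI: "\<And>h. h \<in> I \<Longrightarrow> f h = 0" and h: "h \<in> I"
  shows "hit f h \<in> I"
proof -
  obtain t where t: "tensor2_eq scale (\<Delta> h) t" "Poly_Mapping.keys t \<subseteq> I \<times> UNIV \<union> UNIV \<times> I"
    using I h unfolding hopf_ideal_def by blast
  have I': "two_sided_ideal I" using I by (simp add: hopf_ideal_def)
  have "(\<Sum>p\<in>Poly_Mapping.keys t. scale (Poly_Mapping.lookup t p) (case p of (a, b) \<Rightarrow> scale (f b) a)) \<in> I"
  proof (rule two_sided_ideal_sum[OF I'], rule two_sided_ideal_scale[OF I'])
    fix p assume "p \<in> Poly_Mapping.keys t"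
    then have "fst p \<in> I \<or> snd p \<in> I" using t(2) by auto
    then show "(case p of (a, b) \<Rightarrow> scale (f b) a) \<in> I"
    proof
      assume "fst p \<in> I"
      then show ?thesis using two_sided_ideal_scale[OF I'] by (simp add: split_def)
    next
      assume "snd p \<in> I"
      then show ?thesis using fI I' by (simp add: split_def two_sided_ideal_def)
    qed
  qed
  then show ?thesis by (simp add: hit_tensor[OF f t(1)] lin_ext_def)
qed

end

section \<open>Generalized Taft algebras\<close>

locale taft = hopf_algebra scale \<Delta> \<epsilon> S
  for scale :: "'k::field \<Rightarrow> 'h::ring_1 \<Rightarrow> 'h" and \<Delta> \<epsilon> S +
  fixes n m :: nat and lam :: 'k and g x :: 'h
  assumes taft: "generalized_taft n lam m scale \<Delta> \<epsilon> S g x"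
    and n_pos: "n > 0" and m_ge_2: "m \<ge> 2" and m_dvd_n: "m dvd n"
    and lam_power_eq_1_iff: "\<And>j. lam ^ j = 1 \<longleftrightarrow> m dvd j"
begin

lemma presented: "presented_by scale (case_gen g x)
    {free_gen Gen1 ^ n - 1, free_gen Gen2 ^ m, free_gen Gen1 * free_gen Gen2 - fscale lam (free_gen Gen2 * free_gen Gen1)}"
  using taft by (simp add: generalized_taft_def Let_def)

lemma comult_g: "tensor2_eq scale (\<Delta> g) (basis_vec (g, g))"
  and comult_x: "tensor2_eq scale (\<Delta> x) (basis_vec (g, x) + basis_vec (x, 1))"
  using taft by (simp_all add: generalized_taft_def Let_def)

lemma g_power_n: "g ^ n = 1" and x_power_m: "x ^ m = 0" and g_x: "g * x = scale lam (x * g)"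
proof -
  note rel = presented_relation[OF presented]
  show "g ^ n = 1" using rel[of "free_gen Gen1 ^ n - 1"] by simp
  show "x ^ m = 0" using rel[of "free_gen Gen2 ^ m"] by simp
  show "g * x = scale lam (x * g)"
    using rel[of "free_gen Gen1 * free_gen Gen2 - fscale lam (free_gen Gen2 * free_gen Gen1)"] by simp
qed

lemma lam_neq_0: "lam \<noteq> 0"
  using lam_power_eq_1_iff[of m] m_ge_2 by (auto simp: power_0_left)

lemma lam_neq_1: "lam \<noteq> 1"
  using lam_power_eq_1_iff[of 1] m_ge_2 by auto

lemma taft_induct [case_names one g x add scale]:
  assumes "Q 1" "\<And>a. Q a \<Longrightarrow> Q (g * a)" "\<And>a. Q a \<Longrightarrow> Q (x * a)"
    "\<And>a b. Q a \<Longrightarrow> Q b \<Longrightarrow> Q (a + b)" "\<And>c a. Q a \<Longrightarrow> Q (scale c a)"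
  shows "Q h"
  using presented
proof (induction h rule: presented_induct)
  case (gen i a) then show ?case using assms(2,3) by (cases i) simp_all
qed (use assms in auto)

lemma taft_rep:
  assumes W: "vector_space scaleW" and G: "Vector_Spaces.linear scaleW scaleW G"
    and X: "Vector_Spaces.linear scaleW scaleW X"
    and "\<And>w. (G ^^ n) w = w" "\<And>w. (X ^^ m) w = 0" "\<And>w. G (X w) = scaleW lam (X (G w))"
  obtains \<rho> where "\<And>w. Vector_Spaces.linear scale scaleW (\<lambda>a. \<rho> a w)"
    "\<And>a. Vector_Spaces.linear scaleW scaleW (\<rho> a)"
    "\<And>w. \<rho> 1 w = w" "\<And>a b w. \<rho> (a * b) w = \<rho> a (\<rho> b w)" "\<rho> g = G" "\<rho> x = X"
proof -
  interpret W: vector_space scaleW by fact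
  have E: "Vector_Spaces.linear scaleW scaleW (case_gen G X i)" for i
    using G X by (cases i) simp_all
  have gen: "free_act scaleW (case_gen G X) (free_gen i) = case_gen G X i" for i
    by (rule ext) simp
  have R: "free_act scaleW (case_gen G X) r w = 0"
    if "r \<in> {free_gen Gen1 ^ n - 1, free_gen Gen2 ^ m, free_gen Gen1 * free_gen Gen2 - fscale lam (free_gen Gen2 * free_gen Gen1)}"
    for r w
    using that assms(4-) by (auto simp: W.free_act_power E gen)
  obtain \<rho> where \<rho>: "\<And>w. Vector_Spaces.linear scale scaleW (\<lambda>a. \<rho> a w)"
    "\<And>a. Vector_Spaces.linear scaleW scaleW (\<rho> a)"
    "\<And>w. \<rho> 1 w = w" "\<And>a b w. \<rho> (a * b) w = \<rho> a (\<rho> b w)"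
    "\<And>i w. \<rho> (case_gen g x i) w = case_gen G X i w"
    by (rule presented_rep[OF presented W E R], assumption) (rule that; assumption)
  have "\<rho> g = G" "\<rho> x = X" using \<rho>(5)[of Gen1] \<rho>(5)[of Gen2] by auto
  then show thesis using that[of \<rho>] \<rho>(1-4) by blast
qed

text \<open>A matrix unit on a two-dimensional space represents \<open>x\<close>, with \<open>g\<close> diagonal with entries \<open>\<lambda>\<close> and \<open>1\<close>.\<close>

lemma x_neq_0: "x \<noteq> 0"
proof
  assume x0: "x = 0"
  let ?s = "pair_scale ((*) :: 'k \<Rightarrow> 'k \<Rightarrow> 'k)"
  define G :: "'k \<times> 'k \<Rightarrow> 'k \<times> 'k" where "G = (\<lambda>(p, q). (lam * p, q))"
  define X :: "'k \<times> 'k \<Rightarrow> 'k \<times> 'k" where "X = (\<lambda>(p, q). (q, 0))"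
  have W: "vector_space ?s"
    by (rule vector_space.vector_space_pair_scale[OF vector_space_field])
  have lin: "Vector_Spaces.linear ?s ?s G" "Vector_Spaces.linear ?s ?s X"
    by (auto simp: Vector_Spaces.linear_iff W G_def X_def pair_scale_def split_def plus_prod_def algebra_simps)
  have "(G ^^ j) (p, q) = (lam ^ j * p, q)" for j p q
    by (induction j) (simp_all add: G_def mult.assoc)
  then have Gn: "(G ^^ n) w = w" for w
    using lam_power_eq_1_iff[of n] m_dvd_n by (cases w) simp
  obtain m' where m': "m = Suc (Suc m')" using m_ge_2 by (metis add_2_eq_Suc le_Suc_ex)
  have "(X ^^ Suc (Suc j)) w = 0" for j w
    by (induction j) (simp_all add: X_def split_def zero_prod_def)
  then have Xm: "(X ^^ m) w = 0" for w unfolding m' .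
  have GX: "G (X w) = ?s lam (X (G w))" for w by (simp add: G_def X_def pair_scale_def split_def)
  obtain \<rho> where "\<And>w. Vector_Spaces.linear scale ?s (\<lambda>a. \<rho> a w)" "\<rho> x = X"
    by (rule taft_rep[OF W lin Gn Xm GX]) (rule that; assumption)
  then have "Vector_Spaces.linear scale ?s (\<lambda>a. \<rho> a (0, 1))" "\<rho> 0 = X" using x0 by auto
  then interpret L: Vector_Spaces.linear scale ?s "\<lambda>a. \<rho> a (0, 1)" by simp
  have "X (0, 1) = 0" using L.zero \<open>\<rho> 0 = X\<close> by simp
  then show False by (simp add: X_def zero_prod_def)
qed

lemma g_power_neq_1:
  assumes "0 < l" "l < n"
  shows "g ^ l \<noteq> 1"
proof
  assume gl: "g ^ l = 1"
  \<comment> \<open>the regular representation of the cyclic group, on which \<open>x\<close> acts by zero; the indices from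
      \<open>n\<close> on are fixed\<close>
  define \<sigma> where "\<sigma> i = (if i < n then Suc i mod n else i)" for i
  define G :: "(nat \<Rightarrow>\<^sub>0 'k) \<Rightarrow> (nat \<Rightarrow>\<^sub>0 'k)" where "G = lin_ext fscale (\<lambda>i. basis_vec (\<sigma> i))"
  have G: "Vector_Spaces.linear fscale fscale G" unfolding G_def by (rule formal.linear_lin_ext)
  define X :: "(nat \<Rightarrow>\<^sub>0 'k) \<Rightarrow> (nat \<Rightarrow>\<^sub>0 'k)" where "X w = 0" for w
  have X: "Vector_Spaces.linear fscale fscale X"
    by (simp add: X_def Vector_Spaces.linear_iff formal.vector_space_axioms)
  have \<sigma>: "(\<sigma> ^^ j) i = (if i < n then (i + j) mod n else i)" for i j
    using n_pos by (induction j) (simp_all add: \<sigma>_def mod_Suc_eq)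
  have Gj: "(G ^^ j) (basis_vec i) = basis_vec ((\<sigma> ^^ j) i)" for i j
    by (induction j) (simp_all add: G_def)
  have Gj_add: "(G ^^ j) (s + t) = (G ^^ j) s + (G ^^ j) t" for s t j
    by (induction j) (simp_all add: G_def)
  have Gj_sc: "(G ^^ j) (fscale c t) = fscale c ((G ^^ j) t)" for c t j
    by (induction j) (simp_all add: G_def)
  have Gn: "(G ^^ n) w = w" for w
    by (induction w rule: formal_induct) (simp_all add: Gj Gj_add Gj_sc \<sigma>)
  have Xm: "(X ^^ m) w = 0" for w
    using m_ge_2 by (cases m) (simp_all add: X_def)
  have GX: "G (X w) = fscale lam (X (G w))" for w by (simp add: G_def X_def)
  obtain \<rho> where \<rho>: "\<And>w. \<rho> 1 w = w" "\<And>a b w. \<rho> (a * b) w = \<rho> a (\<rho> b w)" "\<rho> g = G"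
    by (rule taft_rep[OF formal.vector_space_axioms G X Gn Xm GX]) (rule that; assumption)
  have "\<rho> (g ^ j) w = (G ^^ j) w" for j w by (induction j) (simp_all add: \<rho>)
  then have "basis_vec ((\<sigma> ^^ l) 0) = (basis_vec 0 :: nat \<Rightarrow>\<^sub>0 'k)"
    using gl \<rho>(1) Gj by metis
  then have "basis_vec l = (basis_vec 0 :: nat \<Rightarrow>\<^sub>0 'k)" using assms by (simp add: \<sigma>)
  then have "Poly_Mapping.keys (basis_vec l :: nat \<Rightarrow>\<^sub>0 'k) = Poly_Mapping.keys (basis_vec 0 :: nat \<Rightarrow>\<^sub>0 'k)" by simp
  then show False using assms by (simp add: basis_vec_def)
qed

lemma g_neq_0: "g \<noteq> 0"
  using g_power_n n_pos by (auto simp: power_0_left)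

lemma counit_g: "\<epsilon> g = 1"
proof -
  have "bilinear_pair scale scale (\<lambda>(a, b). scale (\<epsilon> a) b)"
    by (simp add: bilinear_pair_def Vector_Spaces.linear_iff vector_space_axioms linear_counit
        scale_right_distrib scale_left_distrib mult.commute)
  from tensor2_eq_lin_ext[OF comult_g this] have "scale (\<epsilon> g) g = scale 1 g"
    using counit_left[of g] by simp
  then show ?thesis using g_neq_0 by (simp only: scale_cancel_right) simp
qed

lemma counit_x: "\<epsilon> x = 0"
proof -
  have "bilinear_pair scale scale (\<lambda>(a, b). scale (\<epsilon> a) b)"
    by (simp add: bilinear_pair_def Vector_Spaces.linear_iff vector_space_axioms linear_counit
        scale_right_distrib scale_left_distrib mult.commute)
  from tensor2_eq_lin_ext[OF comult_x this] have "x + scale (\<epsilon> x) 1 = x"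
    using counit_left[of x] by (simp add: counit_g)
  then show ?thesis by simp
qed

lemma bilinear_antipode:
  "bilinear_pair scale scale (\<lambda>(c, d). S (a * c) * (b * d))"
  by (simp add: bilinear_pair_def Vector_Spaces.linear_iff vector_space_axioms linear_antipode distrib_left
      distrib_right scale_mult_right[symmetric] scale_mult_left[symmetric])

lemma antipode_g: "S g * g = 1" "g * S g = 1"
proof -
  have b: "bilinear_pair scale scale (\<lambda>(a, b). S a * b)" "bilinear_pair scale scale (\<lambda>(a, b). a * S b)"
    by (simp_all add: bilinear_pair_def Vector_Spaces.linear_iff vector_space_axioms linear_antipode distrib_left
      distrib_right scale_mult_right[symmetric] scale_mult_left[symmetric])
  show "S g * g = 1" using tensor2_eq_lin_ext[OF comult_g b(1)] antipode_left[of g] by (simp add: counit_g)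
  show "g * S g = 1" using tensor2_eq_lin_ext[OF comult_g b(2)] antipode_right[of g] by (simp add: counit_g)
qed

lemma antipode_x: "S x = - (S g * x)"
proof -
  have "S g * x + S x = 0"
    using tensor2_eq_lin_ext[OF comult_x bilinear_antipode[of 1 1]] antipode_left[of x] by (simp add: counit_x)
  then show ?thesis by (simp add: eq_neg_iff_add_eq_0 add.commute)
qed

lemma antipode_one: "S 1 = 1"
  using comult_lin_ext(3)[OF bilinear_antipode[of 1 1]] antipode_left[of 1] by (simp add: counit_one)

text \<open>The antipode axiom for \<open>h g\<close> reads \<open>S (h\<^sub>1 g) h\<^sub>2 g = \<epsilon> h\<close>, so \<open>h \<mapsto> S (h g)\<close> is a left
  convolution inverse of the identity up to the factor \<open>S g\<close>. The axiom for \<open>h x\<close> gives the same for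
  \<open>h \<mapsto> S (h x)\<close> and the factor \<open>S x\<close>. Antimultiplicativity of \<open>S\<close> follows by induction over products
  of generators.\<close>

lemma antipode_mult_g: "S (h * g) = S g * S h"
  and antipode_mult_x: "S (h * x) = S x * S h"
proof -
  have lin: "Vector_Spaces.linear scale scale (\<lambda>h. S (h * b))" for b
    by (simp add: Vector_Spaces.linear_iff vector_space_axioms linear_antipode distrib_right scale_mult_left[symmetric])
  have anti: "lin_ext scale (\<lambda>(a, b). lin_ext scale (\<lambda>(c, d). S (a * c) * (b * d)) (\<Delta> h')) (\<Delta> h) = scale (\<epsilon> (h * h')) 1" for h h'
    using comult_lin_ext(4)[OF bilinear_antipode[of 1 1], of h h'] antipode_left[of "h * h'"] by simp
  have G: "lin_ext scale (\<lambda>(a, b). S (a * g) * b) (\<Delta> h) = scale (\<epsilon> h) (S g)" (is "?X = _") for h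
  proof -
    have "lin_ext scale (\<lambda>(a, b). S (a * g) * (b * g)) (\<Delta> h) = scale (\<epsilon> h) 1"
      using anti[of g h] by (simp add: tensor2_eq_lin_ext[OF comult_g bilinear_antipode] counit_mult counit_g)
    moreover have "lin_ext scale (\<lambda>(a, b). S (a * g) * (b * g)) (\<Delta> h) = ?X * g"
      using lin_ext_comp[OF linear_mult_right[of g], of "\<lambda>(a, b). S (a * g) * b" "\<Delta> h"]
      by (simp add: split_def mult.assoc)
    ultimately have "?X * g * S g = scale (\<epsilon> h) 1 * S g" by simp
    then show ?thesis by (simp add: mult.assoc antipode_g scale_mult_left[symmetric])
  qed
  show "S (h * g) = S g * S h" for h by (rule left_convolution_inverse[OF lin G])
  have X: "lin_ext scale (\<lambda>(a, b). S (a * x) * b) (\<Delta> h) = scale (\<epsilon> h) (S x)" (is "?Y = _") for h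
  proof -
    have "lin_ext scale (\<lambda>(a, b). S (a * g) * (b * x) + S (a * x) * b) (\<Delta> h) = 0"
      using anti[of x h] by (simp add: tensor2_eq_lin_ext[OF comult_x bilinear_antipode] counit_mult counit_x)
    moreover have "lin_ext scale (\<lambda>(a, b). S (a * g) * (b * x)) (\<Delta> h) = scale (\<epsilon> h) (S g) * x"
      using lin_ext_comp[OF linear_mult_right[of x], of "\<lambda>(a, b). S (a * g) * b" "\<Delta> h"] G[of h]
      by (simp add: split_def mult.assoc)
    ultimately have "scale (\<epsilon> h) (S g) * x + ?Y = 0"
      by (simp add: split_def lin_ext_fun_add)
    then show ?thesis by (simp add: antipode_x scale_mult_left[symmetric] eq_neg_iff_add_eq_0 add.commute)
  qed
  show "S (h * x) = S x * S h" for h by (rule left_convolution_inverse[OF lin X])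
qed

lemma antipode_mult: "S (h * b) = S b * S h"
proof (induction b arbitrary: h rule: taft_induct)
  case one then show ?case by (simp add: antipode_one)
next
  case (g a) then show ?case using g[of "h * g"] g[of g] by (simp add: antipode_mult_g mult.assoc)
next
  case (x a) then show ?case using x[of "h * x"] x[of x] by (simp add: antipode_mult_x mult.assoc)
next
  case (add a b) then show ?case by (simp add: distrib_left distrib_right linear_antipode)
next
  case (scale c a) then show ?case
    by (simp add: scale_mult_right[symmetric] scale_mult_left[symmetric] linear_antipode)
qed

lemma comult_g_power: "tensor2_eq scale (\<Delta> (g ^ l)) (basis_vec (g ^ l, g ^ l))"
proof (induction l)
  case 0 then show ?case by (simp add: comult_one)
next
  case (Suc l)
  note comult_mult[of g "g ^ l"]
  also note tensor_mult_cong(2)[OF comult_g]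
  also note tensor_mult_cong(1)[OF Suc]
  finally show ?case by simp
qed

lemma hopf_ideal_x: "hopf_ideal scale \<Delta> \<epsilon> S (ideal_generated {x})"
proof (rule hopf_ideal_generated[OF antipode_mult comult_x])
  have x: "x \<in> ideal_generated {x}" using ideal_generated_superset[of "{x}"] by blast
  show "Poly_Mapping.keys (basis_vec (g, x) + basis_vec (x, 1) :: 'h \<times> 'h \<Rightarrow>\<^sub>0 'k)
    \<subseteq> ideal_generated {x} \<times> UNIV \<union> UNIV \<times> ideal_generated {x}"
    using keys_add[of "basis_vec (g, x) :: 'h \<times> 'h \<Rightarrow>\<^sub>0 'k" "basis_vec (x, 1)"] x
    by (auto simp: basis_vec_def)
  have "- S g * x \<in> ideal_generated {x}"
    using x ideal_generated_ideal[of "{x}"] unfolding two_sided_ideal_def by blast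
  then show "S x \<in> ideal_generated {x}" by (simp add: antipode_x)
qed (rule counit_x)

lemma hopf_ideal_g_power: "hopf_ideal scale \<Delta> \<epsilon> S (ideal_generated {g ^ l - 1})"
proof (rule hopf_ideal_generated[OF antipode_mult])
  let ?z = "g ^ l - 1"
  have z: "?z \<in> ideal_generated {?z}" using ideal_generated_superset[of "{?z}"] by blast
  let ?t = "basis_vec (?z, g ^ l) + basis_vec (1, ?z) :: 'h \<times> 'h \<Rightarrow>\<^sub>0 'k"
  have "tensor2_eq scale (\<Delta> ?z + basis_vec (1, 1)) (\<Delta> ?z + \<Delta> 1)"
    by (rule tensor2_eq_add[OF tensor2_eq_refl tensor2_eq_sym[OF comult_one]])
  also have "tensor2_eq scale \<dots> (\<Delta> (g ^ l))"
    using tensor2_eq_sym[OF comult_add[of ?z 1]] by simp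
  also note comult_g_power
  finally have "tensor2_eq scale (\<Delta> ?z) (basis_vec (g ^ l, g ^ l) - basis_vec (1, 1))"
    by (simp add: tensor2_eq_def algebra_simps)
  also have "tensor2_eq scale \<dots> ?t"
    using tensor2_eq_sym[OF tensor2_eq_add[OF tensor2_eq_diff1[of scale "g ^ l" 1 "g ^ l"] tensor2_eq_diff2[of scale 1 "g ^ l" 1]]]
    by simp
  finally show "tensor2_eq scale (\<Delta> ?z) ?t" .
  show "Poly_Mapping.keys ?t \<subseteq> ideal_generated {?z} \<times> UNIV \<union> UNIV \<times> ideal_generated {?z}"
    using keys_add[of "basis_vec (?z, g ^ l) :: 'h \<times> 'h \<Rightarrow>\<^sub>0 'k" "basis_vec (1, ?z)"] z
    by (auto simp: basis_vec_def)
  have "\<epsilon> (g ^ l) = 1" by (induction l) (simp_all add: counit_one counit_mult counit_g)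
  then show "\<epsilon> ?z = 0" by (simp add: linear_counit counit_one)
  have "S (g ^ l) = S g ^ l"
    by (induction l) (simp_all add: antipode_one antipode_mult power_commutes)
  moreover have "S g ^ l * g ^ l = 1" using antipode_g(1) by (rule left_right_inverse_power)
  ultimately have "S ?z = - (S g ^ l) * ?z"
    by (simp add: linear_antipode antipode_one algebra_simps)
  then show "S ?z \<in> ideal_generated {?z}"
    using z ideal_generated_ideal[of "{?z}"] unfolding two_sided_ideal_def by metis
qed

lemma g_power_x: "g ^ i * x = scale (lam ^ i) (x * g ^ i)"
proof (induction i)
  case (Suc i)
  have "g ^ Suc i * x = g * (g ^ i * x)" by (simp add: mult.assoc)
  also have "\<dots> = scale (lam ^ i) (g * x * g ^ i)"
    by (simp add: Suc scale_mult_right[symmetric] mult.assoc)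
  also have "\<dots> = scale (lam ^ Suc i) (x * g ^ Suc i)"
    by (simp add: g_x scale_mult_left[symmetric] mult.assoc mult.commute)
  finally show ?case .
qed simp

lemma x_g_power: "x * g ^ i = scale (inverse lam ^ i) (g ^ i * x)"
  using lam_neq_0 by (simp add: g_power_x power_mult_distrib[symmetric])

lemma g_x_power: "g * x ^ j = scale (lam ^ j) (x ^ j * g)"
proof (induction j)
  case (Suc j)
  have "g * x ^ Suc j = scale lam (x * (g * x ^ j))"
    by (simp add: g_x scale_mult_left[symmetric] mult.assoc[symmetric])
  also have "\<dots> = scale (lam ^ Suc j) (x ^ Suc j * g)"
    by (simp add: Suc scale_mult_right[symmetric] mult.assoc mult.commute)
  finally show ?case .
qed simp

lemma monomials_span: "h \<in> span ((\<lambda>(i, j). g ^ i * x ^ j) ` ({..<n} \<times> {..<m}))" (is "_ \<in> span ?M")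
proof (induction h rule: taft_induct)
  case one
  have "(0, 0) \<in> {..<n} \<times> {..<m}" using n_pos m_ge_2 by simp
  from imageI[OF this, of "\<lambda>(i, j). g ^ i * x ^ j"] show ?case by (intro span_base) simp
next
  case (g a) then show ?case
  proof (induction a rule: span_induct_alt)
    case base then show ?case by (simp add: span_zero)
  next
    case (step c b y)
    then obtain i j where ij: "i < n" "j < m" "b = g ^ i * x ^ j" by auto
    have "g * b = g ^ (Suc i mod n) * x ^ j"
    proof (cases "Suc i < n")
      case False
      then have "Suc i = n" using ij by simp
      then show ?thesis using g_power_n ij by (metis mod_self mult.assoc power_0 power_Suc)
    qed (simp add: ij mult.assoc)
    then have "g * b \<in> ?M" using ij n_pos by force
    then show ?case
      using step by (simp add: distrib_left scale_mult_right[symmetric] span_add span_scale span_base)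
  qed
next
  case (x a) then show ?case
  proof (induction a rule: span_induct_alt)
    case base then show ?case by (simp add: span_zero)
  next
    case (step c b y)
    then obtain i j where ij: "i < n" "j < m" "b = g ^ i * x ^ j" by auto
    have xb: "x * b = scale (inverse lam ^ i) (g ^ i * x ^ Suc j)"
      by (simp add: ij mult.assoc[symmetric] x_g_power scale_mult_left[symmetric])
    have "g ^ i * x ^ Suc j \<in> span ?M"
    proof (cases "Suc j < m")
      case True
      then show ?thesis using ij by (intro span_base) force
    next
      case False
      then have "Suc j = m" using ij by simp
      then have "x ^ Suc j = 0" using x_power_m by simp
      then show ?thesis by (simp add: span_zero)
    qed
    then have "x * b \<in> span ?M" unfolding xb by (rule span_scale)
    then show ?case
      using step by (simp add: distrib_left scale_mult_right[symmetric] span_add span_scale)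
  qed
qed (simp_all add: span_add span_scale)

end

section \<open>Actions of generalized Taft algebras\<close>

text \<open>The operator \<open>P - e b\<close> annihilates the summand at \<open>b\<close> and multiplies the one at \<open>v\<close> by \<open>e v - e b\<close>, so
  induction on the number of summands yields all summands except the one at \<open>b\<close>, which is then the
  difference.\<close>

lemma (in vector_space) joint_eigenvectors_split:
  assumes I: "subspace I" and B: "finite B"
    and sep: "\<And>v w. v \<in> B \<Longrightarrow> w \<in> B \<Longrightarrow> v \<noteq> w \<Longrightarrow>
      \<exists>P e. Vector_Spaces.linear scale scale P \<and> (\<forall>h\<in>I. P h \<in> I) \<and> (\<forall>b\<in>B. P b = scale (e b) b) \<and> e v \<noteq> e w"
    and sum: "(\<Sum>v\<in>B. scale (c v) v) \<in> I" and v: "v \<in> B"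
  shows "scale (c v) v \<in> I"
  using B sep sum v
proof (induction B arbitrary: c v rule: finite_induct)
  case (insert b B)
  let ?h = "\<Sum>v\<in>insert b B. scale (c v) v"
  have old: "scale (c v) v \<in> I" if v: "v \<in> B" for v
  proof -
    have vb: "v \<noteq> b" using v insert.hyps by auto
    obtain P e where P: "Vector_Spaces.linear scale scale P" "\<forall>h\<in>I. P h \<in> I"
      "\<forall>w\<in>insert b B. P w = scale (e w) w" "e v \<noteq> e b"
      using insert.prems(1)[OF insertI2[OF v] insertI1 vb] by blast
    interpret P: Vector_Spaces.linear scale scale P by (rule P(1))
    let ?c = "\<lambda>w. c w * (e w - e b)"
    \<comment> \<open>the summand at \<open>b\<close> cancels\<close>
    have "P ?h - scale (e b) ?h = (\<Sum>w\<in>B. scale (?c w) w)"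
    proof -
      have "P ?h = (\<Sum>w\<in>insert b B. scale (c w * e w) w)"
        unfolding P.sum by (rule sum.cong) (use P(3) in \<open>simp_all only: P.scale scale_scale\<close>)
      moreover have "scale (e b) ?h = (\<Sum>w\<in>insert b B. scale (c w * e b) w)"
        unfolding scale_sum_right by (rule sum.cong) (simp_all add: mult.commute)
      ultimately have "P ?h - scale (e b) ?h = (\<Sum>w\<in>insert b B. scale (?c w) w)"
        by (simp only: sum_subtractf[symmetric] scale_left_diff_distrib[symmetric] right_diff_distrib)
      then show ?thesis using insert.hyps by simp
    qed
    moreover have "P ?h - scale (e b) ?h \<in> I"
      using P(2) insert.prems(2) by (intro subspace_diff[OF I] subspace_scale[OF I]) auto
    ultimately have sum: "(\<Sum>w\<in>B. scale (?c w) w) \<in> I" by simp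
    have "scale (?c v) v \<in> I"
    proof (rule insert.IH[OF _ sum v])
      fix v' w assume "v' \<in> B" "w \<in> B" "v' \<noteq> w"
      from insert.prems(1)[OF insertI2[OF this(1)] insertI2[OF this(2)] this(3)]
      show "\<exists>P e. Vector_Spaces.linear scale scale P \<and> (\<forall>h\<in>I. P h \<in> I) \<and> (\<forall>b\<in>B. P b = scale (e b) b) \<and> e v' \<noteq> e w"
        by blast
    qed
    then have "scale (inverse (e v - e b)) (scale (?c v) v) \<in> I"
      using I by (rule subspace_scale[rotated])
    moreover have "inverse (e v - e b) * ?c v = c v" using P(4) by (simp add: field_simps)
    ultimately show ?thesis by (simp only: scale_scale)
  qed
  show ?case
  proof (cases "v = b")
    case True
    have "scale (c b) b = ?h - (\<Sum>v\<in>B. scale (c v) v)" using insert.hyps by simp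
    also have "\<dots> \<in> I"
      by (rule subspace_diff[OF I insert.prems(2) subspace_sum[OF I old]])
    finally show ?thesis using True by simp
  next
    case False
    then show ?thesis using old insert.prems(3) by auto
  qed
qed simp

locale taft_action = taft scale \<Delta> \<epsilon> S n m lam g x + A: k_algebra scaleA
  for scale :: "'k::field \<Rightarrow> 'h::ring_1 \<Rightarrow> 'h" and \<Delta> \<epsilon> S n m lam g x
    and scaleA :: "'k \<Rightarrow> 'a::ring_1 \<Rightarrow> 'a" +
  fixes act :: "'h \<Rightarrow> 'a \<Rightarrow> 'a"
  assumes module_algebra: "module_algebra scale \<Delta> \<epsilon> scaleA act"
begin

lemma act_left: "act (h + h') a = act h a + act h' a" "act (scale c h) a = scaleA c (act h a)"
    "act (h - h') a = act h a - act h' a" "act 0 a = 0"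
  and act_right: "act h (a + b) = act h a + act h b" "act h (scaleA c a) = scaleA c (act h a)"
    "act h (a - b) = act h a - act h b" "act h 0 = 0"
proof -
  interpret l: Vector_Spaces.linear scale scaleA "\<lambda>h. act h a"
    using module_algebra by (simp add: module_algebra_def)
  interpret r: Vector_Spaces.linear scaleA scaleA "act h"
    using module_algebra by (simp add: module_algebra_def)
  show "act (h + h') a = act h a + act h' a" "act (scale c h) a = scaleA c (act h a)"
    "act (h - h') a = act h a - act h' a" "act 0 a = 0"
    by (rule l.add l.scale l.diff l.zero)+
  show "act h (a + b) = act h a + act h b" "act h (scaleA c a) = scaleA c (act h a)"
    "act h (a - b) = act h a - act h b" "act h 0 = 0"
    by (rule r.add r.scale r.diff r.zero)+
qed

lemma act_one [simp]: "act 1 a = a"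
  and act_mult: "act (h * h') a = act h (act h' a)"
  and act_unit: "act h 1 = scaleA (\<epsilon> h) 1"
  and act_prod: "act h (a * b) = lin_ext scaleA (\<lambda>(h1, h2). act h1 a * act h2 b) (\<Delta> h)"
  using module_algebra by (simp_all add: module_algebra_def)

lemma act_power: "act (h ^ j) a = (act h ^^ j) a"
  by (induction j) (simp_all add: act_mult)

lemma bilinear_act: "bilinear_pair scale scaleA (\<lambda>(h1, h2). act h1 a * act h2 b)"
  by (simp add: bilinear_pair_def Vector_Spaces.linear_iff vector_space_axioms A.vector_space_axioms act_left
      distrib_left distrib_right A.scale_mult_left[symmetric] A.scale_mult_right[symmetric])

lemma act_g_mult: "act g (a * b) = act g a * act g b"
  and act_x_mult: "act x (a * b) = act g a * act x b + act x a * b"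
  by (simp_all add: act_prod tensor2_eq_lin_ext[OF comult_g bilinear_act] tensor2_eq_lin_ext[OF comult_x bilinear_act])

lemma two_sided_ideal_annihilator: "two_sided_ideal {h. \<forall>a. act h a = 0}"
  by (simp add: two_sided_ideal_def act_left act_mult act_right)

lemma eigenvalue_power_n:
  assumes "act g w = scaleA \<alpha> w" "w \<noteq> 0"
  shows "\<alpha> ^ n = 1"
proof -
  have "act (g ^ j) w = scaleA (\<alpha> ^ j) w" for j
    by (induction j) (simp_all add: act_mult act_right assms(1) mult.commute)
  from this[of n] have "scaleA (\<alpha> ^ n) w = scaleA 1 w" by (simp add: g_power_n)
  then show ?thesis using assms(2) by (simp only: A.scale_cancel_right) simp
qed

lemma linear_actionI:
  assumes "act g u \<in> A.span {u, v}" "act g v \<in> A.span {u, v}" "act x u \<in> A.span {u, v}" "act x v \<in> A.span {u, v}"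
  shows "linear_action scaleA u v g x act"
proof -
  have "act h w \<in> A.span {u, v}" if "w \<in> A.span {u, v}" "act h u \<in> A.span {u, v}" "act h v \<in> A.span {u, v}" for h w
    using that(1)
  proof (induction w rule: A.span_induct_alt)
    case base then show ?case by (simp add: act_right A.span_zero)
  next
    case (step c w w')
    then show ?case using that(2,3) by (auto simp: act_right intro!: A.span_add A.span_scale)
  qed
  then show ?thesis unfolding linear_action_def using assms by blast
qed

lemma inner_faithful_generated:
  assumes "inner_faithful scale \<Delta> \<epsilon> S act" "hopf_ideal scale \<Delta> \<epsilon> S (ideal_generated {z})"
    and "\<And>a. act z a = 0"
  shows "z = 0"
proof (rule ccontr)
  assume "z \<noteq> 0"
  then have "ideal_generated {z} \<noteq> {0}" using ideal_generated_superset[of "{z}"] by auto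
  moreover have "ideal_generated {z} \<subseteq> {h. \<forall>a. act h a = 0}"
    by (rule ideal_generated_least[OF two_sided_ideal_annihilator]) (simp add: assms(3))
  ultimately show False using assms(1,2) unfolding inner_faithful_def by blast
qed

text \<open>The matrix coefficients of the two-dimensional module spanned by \<open>y\<close> and \<open>z\<close> vanish on a Hopf ideal
  \<open>I\<close> that annihilates it, so \<open>I\<close> is stable under the operators \<open>hit f\<close> given by these coefficients.
  Those of the two diagonal coefficients and the conjugation by \<open>g\<close> have the monomials \<open>g\<^sup>i x\<^sup>j\<close> with
  \<open>i < n\<close> and \<open>j < m\<close> as joint eigenvectors, with eigenvalues \<open>\<alpha>\<^sup>i\<close>, \<open>\<delta>\<^sup>i\<close> and \<open>\<lambda>\<^sup>j\<close> that determine \<open>i\<close> and \<open>j\<close>.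
  So if \<open>I\<close> is nonzero, it contains some \<open>g\<^sup>i x\<^sup>j\<close> and hence \<open>x\<^sup>j\<close>. The operator of the off-diagonal
  coefficient is a skew derivation that sends \<open>x\<^sup>j\<close> to a nonzero multiple of \<open>g x\<^sup>j\<^sup>-\<^sup>1\<close> for \<open>0 < j < m\<close>, so
  \<open>I\<close> contains \<open>1\<close> by descent on \<open>j\<close>.\<close>

lemma inner_faithful_triangular:
  assumes indep: "\<And>p q. scaleA p y + scaleA q z = 0 \<Longrightarrow> p = 0 \<and> q = 0"
    and gy: "act g y = scaleA \<alpha> y" and gz: "act g z = scaleA \<delta> z"
    and xy: "act x y = 0" and xz: "act x z = scaleA \<eta> y" and \<eta>: "\<eta> \<noteq> 0"
    and sep: "\<And>i. \<alpha> ^ i = 1 \<Longrightarrow> \<delta> ^ i = 1 \<Longrightarrow> n dvd i"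
  shows "inner_faithful scale \<Delta> \<epsilon> S act"
  unfolding inner_faithful_def
proof
  assume "\<exists>I. hopf_ideal scale \<Delta> \<epsilon> S I \<and> I \<noteq> {0} \<and> (\<forall>h\<in>I. \<forall>a. act h a = 0)"
  then obtain I where I: "hopf_ideal scale \<Delta> \<epsilon> S I" "I \<noteq> {0}" and ann: "\<And>h a. h \<in> I \<Longrightarrow> act h a = 0"
    by blast
  have ideal: "two_sided_ideal I" using I by (simp add: hopf_ideal_def)
  have eq: "a = a' \<and> b = b'" if "scaleA a z + scaleA b y = scaleA a' z + scaleA b' y" for a b a' b'
  proof -
    have "scaleA (b - b') y + scaleA (a - a') z = 0"
      using that by (simp add: A.scale_left_diff_distrib algebra_simps)
    then show ?thesis using indep by fastforce
  qed
  have eqy: "b = b'" if "scaleA b y = scaleA b' y" for b b' using eq[of 0 b 0 b'] that by simp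
  have "\<exists>a d b. act h y = scaleA a y \<and> act h z = scaleA d z + scaleA b y" for h
  proof (induction h rule: taft_induct)
    case one show ?case by (intro exI[of _ 1] exI[of _ 0]) simp
  next
    case (g h)
    then obtain a d b where "act h y = scaleA a y" "act h z = scaleA d z + scaleA b y" by blast
    then show ?case
      by (intro exI[of _ "a * \<alpha>"] exI[of _ "d * \<delta>"] exI[of _ "b * \<alpha>"]) (simp add: act_mult act_right gy gz)
  next
    case (x h)
    then obtain a d b where "act h y = scaleA a y" "act h z = scaleA d z + scaleA b y" by blast
    then show ?case
      by (intro exI[of _ 0] exI[of _ "d * \<eta>"]) (simp add: act_mult act_right xy xz)
  next
    case (add h h')
    then obtain a d b a' d' b' where "act h y = scaleA a y" "act h z = scaleA d z + scaleA b y"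
      "act h' y = scaleA a' y" "act h' z = scaleA d' z + scaleA b' y" by blast
    then show ?case
      by (intro exI[of _ "a + a'"] exI[of _ "d + d'"] exI[of _ "b + b'"]) (simp add: act_left A.scale_left_distrib)
  next
    case (scale c h)
    then obtain a d b where "act h y = scaleA a y" "act h z = scaleA d z + scaleA b y" by blast
    then show ?case
      by (intro exI[of _ "c * a"] exI[of _ "c * d"] exI[of _ "c * b"]) (simp add: act_left A.scale_right_distrib)
  qed
  then obtain al de be where hy: "\<And>h. act h y = scaleA (al h) y"
    and hz: "\<And>h. act h z = scaleA (de h) z + scaleA (be h) y" by metis
  \<comment> \<open>\<open>al\<close> and \<open>de\<close> are the diagonal matrix coefficients, \<open>be\<close> is the off-diagonal one\<close>
  have al: "Vector_Spaces.linear scale (*) al"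
    unfolding Vector_Spaces.linear_iff
    by (intro conjI allI vector_space_axioms vector_space_field eqy)
      (simp_all add: hy[symmetric] act_left A.scale_left_distrib A.scale_scale[symmetric] del: A.scale_scale)
  have debe: "de (h + h') = de h + de h' \<and> be (h + h') = be h + be h'"
    "de (scale c h) = c * de h \<and> be (scale c h) = c * be h" for h h' c
  proof -
    have "scaleA (de (h + h')) z + scaleA (be (h + h')) y =
        (scaleA (de h) z + scaleA (be h) y) + (scaleA (de h') z + scaleA (be h') y)"
      unfolding hz[symmetric] by (rule act_left)
    then show "de (h + h') = de h + de h' \<and> be (h + h') = be h + be h'"
      by (intro eq) (simp add: A.scale_left_distrib)
    have "scaleA (de (scale c h)) z + scaleA (be (scale c h)) y = scaleA c (scaleA (de h) z + scaleA (be h) y)"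
      unfolding hz[symmetric] by (rule act_left)
    then show "de (scale c h) = c * de h \<and> be (scale c h) = c * be h"
      by (intro eq) (simp add: A.scale_right_distrib)
  qed
  have de: "Vector_Spaces.linear scale (*) de" and be: "Vector_Spaces.linear scale (*) be"
    by (simp_all add: Vector_Spaces.linear_iff vector_space_axioms vector_space_field debe)
  have al_mult: "al (h * h') = al h * al h'" for h h'
  proof (rule eqy)
    have "scaleA (al (h * h')) y = act h (act h' y)"
      using hy[of "h * h'"] by (simp add: act_mult)
    also have "\<dots> = scaleA (al h * al h') y" by (simp add: hy act_right mult.commute)
    finally show "scaleA (al (h * h')) y = scaleA (al h * al h') y" .
  qed
  have debe_mult: "de (h * h') = de h * de h' \<and> be (h * h') = be h * de h' + al h * be h'" for h h'
  proof (rule eq)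
    have "scaleA (de (h * h')) z + scaleA (be (h * h')) y = act h (act h' z)"
      using hz[of "h * h'"] by (simp add: act_mult)
    also have "\<dots> = scaleA (de h * de h') z + scaleA (be h * de h' + al h * be h') y"
      by (simp add: hz hy act_right A.scale_right_distrib A.scale_left_distrib mult.commute)
    finally show "scaleA (de (h * h')) z + scaleA (be (h * h')) y =
      scaleA (de h * de h') z + scaleA (be h * de h' + al h * be h') y" .
  qed
  have al_vals: "al g = \<alpha>" "al x = 0" "al 1 = 1"
    using hy[of g] hy[of x] hy[of 1] gy xy by (auto intro!: eqy)
  have debe_vals: "de g = \<delta> \<and> be g = 0" "de x = 0 \<and> be x = \<eta>" "de 1 = 1 \<and> be 1 = 0"
    using hz[of g] hz[of x] hz[of 1] gz xz by (auto intro!: eq)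
  have al_I: "al h = 0" if "h \<in> I" for h
    using hy[of h] ann[OF that, of y] eqy[of "al h" 0] by simp
  have debe_I: "de h = 0 \<and> be h = 0" if "h \<in> I" for h
    using hz[of h] ann[OF that, of z] eq[of "de h" "be h" 0 0] by simp

  have hit0: "hit (\<lambda>_. 0) h = 0" for h by (simp add: hit_def lin_ext_def split_def)
  have hit_al_mult: "hit al (h * h') = hit al h * hit al h'" for h h'
    using hit_mult[OF al, of al al "\<lambda>_. 0" "\<lambda>_. 0"] by (simp add: al_mult hit0)
  have hit_de_mult: "hit de (h * h') = hit de h * hit de h'" for h h'
    using hit_mult[OF de, of de de "\<lambda>_. 0" "\<lambda>_. 0"] by (simp add: debe_mult hit0)
  have hit_be_mult: "hit be (h * h') = hit be h * hit de h' + hit al h * hit be h'" for h h'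
    by (rule hit_mult[OF be]) (simp add: debe_mult)
  have hit_one: "hit f 1 = scale (f 1) 1" and hit_g: "hit f g = scale (f g) g"
    and hit_x: "hit f x = scale (f x) g + scale (f 1) x" if "Vector_Spaces.linear scale (*) f" for f
    using hit_tensor[OF that comult_one] hit_tensor[OF that comult_g] hit_tensor[OF that comult_x] by simp_all
  have hit_al_pow: "hit al (g ^ i * x ^ j) = scale (\<alpha> ^ i) (g ^ i * x ^ j)"
    and hit_de_pow: "hit de (g ^ i * x ^ j) = scale (\<delta> ^ i) (g ^ i * x ^ j)" for i j
  proof -
    have "hit al (g ^ i) = scale (\<alpha> ^ i) (g ^ i)" "hit de (g ^ i) = scale (\<delta> ^ i) (g ^ i)"
      by (induction i) (simp_all add: hit_al_mult hit_de_mult hit_one hit_g al de al_vals debe_vals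
          scale_mult_left[symmetric] scale_mult_right[symmetric] mult.commute)
    moreover have "hit al (x ^ j) = x ^ j" "hit de (x ^ j) = x ^ j"
      by (induction j) (simp_all add: hit_al_mult hit_de_mult hit_one hit_x al de al_vals debe_vals)
    ultimately show "hit al (g ^ i * x ^ j) = scale (\<alpha> ^ i) (g ^ i * x ^ j)"
      "hit de (g ^ i * x ^ j) = scale (\<delta> ^ i) (g ^ i * x ^ j)"
      by (simp_all add: hit_al_mult hit_de_mult scale_mult_left[symmetric])
  qed
  have hit_de_x: "hit de (x ^ j) = x ^ j" for j using hit_de_pow[of 0 j] by simp
  \<comment> \<open>the skew Leibniz rule adds one power of \<open>inverse lam\<close> for each \<open>x\<close> that \<open>g\<close> is moved past\<close>
  have hit_be_x: "hit be (x ^ Suc j) = scale (\<eta> * (\<Sum>s\<le>j. inverse lam ^ s)) (g * x ^ j)" for j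
  proof (induction j)
    case 0 show ?case by (simp add: hit_x be debe_vals)
  next
    case (Suc j)
    let ?c = "\<eta> * (\<Sum>s\<le>j. inverse lam ^ s)"
    have "hit be (x ^ Suc (Suc j)) = hit be (x * x ^ Suc j)" by simp
    also have "\<dots> = scale \<eta> g * x ^ Suc j + x * scale ?c (g * x ^ j)"
      unfolding hit_be_mult by (simp only: Suc hit_de_x) (simp add: hit_x be al debe_vals al_vals)
    also have "x * scale ?c (g * x ^ j) = scale (inverse lam * ?c) (g * x ^ Suc j)"
      using x_g_power[of 1]
      by (simp add: scale_mult_right[symmetric] scale_mult_left[symmetric] mult.assoc[symmetric] mult.commute)
    also have "scale \<eta> g * x ^ Suc j + \<dots> = scale (\<eta> + inverse lam * ?c) (g * x ^ Suc j)"
      by (simp add: scale_left_distrib scale_mult_left[symmetric])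
    also have "\<eta> + inverse lam * ?c = \<eta> * (\<Sum>s\<le>Suc j. inverse lam ^ s)"
      unfolding sum.atMost_Suc_shift by (simp add: algebra_simps sum_distrib_left)
    finally show ?case .
  qed

  have smult: "g ^ i * h \<in> I" "h * g ^ i \<in> I" "g * h \<in> I" if "h \<in> I" for h i
    using ideal that by (auto simp: two_sided_ideal_def)
  have no_power: "x ^ j \<notin> I" if "j < m" for j
    using that
  proof (induction j)
    case 0
    have "y \<noteq> 0" using indep[of 1 0] by auto
    then show ?case using ann[of 1 y] by auto
  next
    case (Suc j)
    show ?case
    proof
      assume "x ^ Suc j \<in> I"
      then have "scale (\<eta> * (\<Sum>s\<le>j. inverse lam ^ s)) (g * x ^ j) \<in> I"
        using hit_hopf_ideal[OF I(1) be] debe_I unfolding hit_be_x[symmetric] by blast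
      moreover have c: "\<eta> * (\<Sum>s\<le>j. inverse lam ^ s) \<noteq> 0" (is "?c \<noteq> 0")
      proof
        assume "?c = 0"
        then have "(1 - inverse lam) * (\<Sum>s\<le>j. inverse lam ^ s) = 0" using \<eta> by simp
        then have "inverse lam ^ Suc j = 1" unfolding sum_gp_basic by simp
        then have "lam ^ Suc j = 1" using lam_neq_0 by (simp add: field_simps)
        then show False using lam_power_eq_1_iff[of "Suc j"] Suc.prems by (auto dest: dvd_imp_le)
      qed
      ultimately have "scale (inverse ?c) (scale ?c (g * x ^ j)) \<in> I"
        using two_sided_ideal_scale[OF ideal] by blast
      then have "g * x ^ j \<in> I" by (simp only: scale_scale left_inverse[OF c] scale_one)
      then have "g ^ (n - 1) * (g * x ^ j) \<in> I" by (rule smult)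
      moreover have "g ^ (n - 1) * (g * x ^ j) = x ^ j"
        using g_power_n n_pos by (simp add: mult.assoc[symmetric] power_Suc2[symmetric] del: power_Suc)
      ultimately show False using Suc by simp
    qed
  qed

  let ?M = "(\<lambda>(i, j). g ^ i * x ^ j) ` ({..<n} \<times> {..<m})"
  \<comment> \<open>an eigenvalue has to be a function of the eigenvector, so exponents are chosen for each monomial\<close>
  define idx where "idx b = (SOME p. fst p < n \<and> snd p < m \<and> g ^ fst p * x ^ snd p = b)" for b
  have idx_n: "fst (idx b) < n" and idx_m: "snd (idx b) < m" and idx_eq: "g ^ fst (idx b) * x ^ snd (idx b) = b"
    if "b \<in> ?M" for b
  proof -
    have "\<exists>p. fst p < n \<and> snd p < m \<and> g ^ fst p * x ^ snd p = b" using that by auto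
    from someI_ex[OF this] show "fst (idx b) < n" "snd (idx b) < m" "g ^ fst (idx b) * x ^ snd (idx b) = b"
      unfolding idx_def by blast+
  qed
  have pow_eq: "c ^ (j - i) = 1" if "c \<noteq> 0" "c ^ i = c ^ j" "i \<le> j" for c :: 'k and i j
    using that by (simp add: power_diff)
  have n1: "\<alpha> ^ n = 1" "\<delta> ^ n = 1"
  proof -
    have "(act g ^^ j) y = scaleA (\<alpha> ^ j) y" "(act g ^^ j) z = scaleA (\<delta> ^ j) z" for j
      by (induction j) (simp_all add: gy gz act_right mult.commute)
    then have "scaleA (\<alpha> ^ n) y = y" "scaleA (\<delta> ^ n) z = z"
      using act_power[of g n] g_power_n by (metis act_one)+
    then show "\<alpha> ^ n = 1" "\<delta> ^ n = 1" using eqy[of "\<alpha> ^ n" 1] eq[of "\<delta> ^ n" 0 1 0] by simp_all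
  qed
  then have nz: "\<alpha> \<noteq> 0" "\<delta> \<noteq> 0" using n_pos by (auto simp: power_0_left)
  have n_inj: "i = j" if "i < n" "j < n" "\<alpha> ^ i = \<alpha> ^ j" "\<delta> ^ i = \<delta> ^ j" for i j
  proof (cases i j rule: linorder_le_cases)
    case le
    show ?thesis using sep[OF pow_eq[OF nz(1) that(3) le] pow_eq[OF nz(2) that(4) le]] that le
      by (auto dest: dvd_imp_le)
  next
    case ge
    show ?thesis using sep[OF pow_eq[OF nz(1) that(3)[symmetric] ge] pow_eq[OF nz(2) that(4)[symmetric] ge]] that ge
      by (auto dest: dvd_imp_le)
  qed
  have m_inj: "i = j" if "i < m" "j < m" "lam ^ i = lam ^ j" for i j
  proof (cases i j rule: linorder_le_cases)
    case le
    show ?thesis using pow_eq[OF lam_neq_0 that(3) le] that le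
      unfolding lam_power_eq_1_iff by (auto dest: dvd_imp_le)
  next
    case ge
    show ?thesis using pow_eq[OF lam_neq_0 that(3)[symmetric] ge] that ge
      unfolding lam_power_eq_1_iff by (auto dest: dvd_imp_le)
  qed
  have subspace: "subspace I"
    using ideal two_sided_ideal_scale[OF ideal] by (simp add: subspace_def two_sided_ideal_def)
  obtain h where h: "h \<in> I" "h \<noteq> 0" using I ideal by (auto simp: two_sided_ideal_def)
  have "finite ?M" by simp
  then obtain c where c: "h = (\<Sum>b\<in>?M. scale (c b) b)"
    using monomials_span[of h] unfolding span_finite[OF \<open>finite ?M\<close>] by blast
  have "\<exists>b\<in>?M. c b \<noteq> 0"
  proof (rule ccontr)
    assume "\<not> ?thesis"
    then have "h = (\<Sum>b\<in>?M. 0)" unfolding c by (intro sum.cong) auto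
    then show False using h(2) by simp
  qed
  then obtain b where b: "b \<in> ?M" "c b \<noteq> 0" by blast
  have "scale (c b) b \<in> I"
  proof (rule joint_eigenvectors_split[OF subspace \<open>finite ?M\<close> _ _ b(1)])
    show "(\<Sum>b\<in>?M. scale (c b) b) \<in> I" using h(1) c by simp
  next
    fix v w assume v: "v \<in> ?M" and w: "w \<in> ?M" and "v \<noteq> w"
    then have neq: "fst (idx v) \<noteq> fst (idx w) \<or> snd (idx v) \<noteq> snd (idx w)" using idx_eq[OF v] idx_eq[OF w] by auto
    consider "\<alpha> ^ fst (idx v) \<noteq> \<alpha> ^ fst (idx w)" | "\<delta> ^ fst (idx v) \<noteq> \<delta> ^ fst (idx w)"
      | "lam ^ snd (idx v) \<noteq> lam ^ snd (idx w)"
    proof (rule ccontr)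
      assume "\<not> thesis"
      then have e: "\<alpha> ^ fst (idx v) = \<alpha> ^ fst (idx w)" "\<delta> ^ fst (idx v) = \<delta> ^ fst (idx w)"
        "lam ^ snd (idx v) = lam ^ snd (idx w)" using that by blast+
      have 1: "fst (idx v) = fst (idx w)"
        by (rule n_inj[OF idx_n[OF v] idx_n[OF w] e(1,2)])
      have 2: "snd (idx v) = snd (idx w)"
        by (rule m_inj[OF idx_m[OF v] idx_m[OF w] e(3)])
      show False using neq 1 2 by blast
    qed
    then show "\<exists>P e. Vector_Spaces.linear scale scale P \<and> (\<forall>h\<in>I. P h \<in> I) \<and>
      (\<forall>b\<in>?M. P b = scale (e b) b) \<and> e v \<noteq> e w"
    proof cases
      case 1
      show ?thesis
      proof (intro exI[of _ "hit al"] exI[of _ "\<lambda>b. \<alpha> ^ fst (idx b)"] conjI ballI 1 linear_hit al)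
        fix b assume "b \<in> ?M"
        then show "hit al b = scale (\<alpha> ^ fst (idx b)) b"
          using hit_al_pow[of "fst (idx b)" "snd (idx b)"] by (simp only: idx_eq)
      qed (rule hit_hopf_ideal[OF I(1) al al_I])
    next
      case 2
      show ?thesis
      proof (intro exI[of _ "hit de"] exI[of _ "\<lambda>b. \<delta> ^ fst (idx b)"] conjI ballI 2 linear_hit de)
        fix b assume "b \<in> ?M"
        then show "hit de b = scale (\<delta> ^ fst (idx b)) b"
          using hit_de_pow[of "fst (idx b)" "snd (idx b)"] by (simp only: idx_eq)
      qed (use hit_hopf_ideal[OF I(1) de] debe_I in blast)
    next
      case 3
      show ?thesis
      proof (intro exI[of _ "\<lambda>h. g * h * g ^ (n - 1)"] exI[of _ "\<lambda>b. lam ^ snd (idx b)"] conjI ballI 3)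
        show "Vector_Spaces.linear scale scale (\<lambda>h. g * h * g ^ (n - 1))"
          by (simp add: Vector_Spaces.linear_iff vector_space_axioms distrib_left distrib_right
              scale_mult_left[symmetric] scale_mult_right[symmetric])
        show "g * h * g ^ (n - 1) \<in> I" if "h \<in> I" for h using that smult by blast
        fix b assume "b \<in> ?M"
        define i j where "i = fst (idx b)" "j = snd (idx b)"
        have b: "b = g ^ i * x ^ j" using idx_eq[OF \<open>b \<in> ?M\<close>] by (simp only: i_j_def)
        have "g * b * g ^ (n - 1) = g ^ i * (g * x ^ j) * g ^ (n - 1)"
          by (simp add: b mult.assoc[symmetric] power_commutes)
        also have "\<dots> = scale (lam ^ j) (g ^ i * x ^ j * (g * g ^ (n - 1)))"
          by (simp add: g_x_power scale_mult_left[symmetric] scale_mult_right[symmetric] mult.assoc)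
        also have "g * g ^ (n - 1) = 1" using n_pos g_power_n by (simp flip: power_Suc)
        finally show "g * b * g ^ (n - 1) = scale (lam ^ snd (idx b)) b"
          unfolding i_j_def(2)[symmetric] by (simp add: b)
      qed
    qed
  qed
  then have "scale (inverse (c b)) (scale (c b) b) \<in> I" by (rule two_sided_ideal_scale[OF ideal])
  then have "b \<in> I" using b(2) by simp
  obtain i j where ij: "i < n" "j < m" "b = g ^ i * x ^ j" using b(1) by auto
  have "g ^ (n - i) * b \<in> I" using \<open>b \<in> I\<close> by (rule smult)
  moreover have "g ^ (n - i) * b = x ^ j"
    using ij g_power_n by (simp add: mult.assoc[symmetric] power_add[symmetric])
  ultimately show False using no_power[OF ij(2)] by simp
qed

end

section \<open>Linear actions on quadratic algebras with two generators\<close>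

text \<open>The words in \<open>u\<close> and \<open>v\<close> span the algebra, in the form of the induction principle that this provides.\<close>

definition generated_by :: "('k \<Rightarrow> 'a::ring_1 \<Rightarrow> 'a) \<Rightarrow> 'a \<Rightarrow> 'a \<Rightarrow> bool" where
  "generated_by scale u v \<longleftrightarrow> (\<forall>Q. Q 1 \<longrightarrow> (\<forall>a. Q a \<longrightarrow> Q (u * a) \<and> Q (v * a)) \<longrightarrow>
     (\<forall>a b. Q a \<longrightarrow> Q b \<longrightarrow> Q (a + b)) \<longrightarrow> (\<forall>c a. Q a \<longrightarrow> Q (scale c a)) \<longrightarrow> (\<forall>a. Q a))"

lemma generated_by_induct [consumes 1, case_names one left right add scale]:
  assumes "generated_by scale u v" "Q 1" "\<And>a. Q a \<Longrightarrow> Q (u * a)" "\<And>a. Q a \<Longrightarrow> Q (v * a)"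
    "\<And>a b. Q a \<Longrightarrow> Q b \<Longrightarrow> Q (a + b)" "\<And>c a. Q a \<Longrightarrow> Q (scale c a)"
  shows "Q a"
  using assms(1)[unfolded generated_by_def, THEN spec, of Q] assms(2-) by simp

context taft_action
begin

lemma x_acts_nontrivially:
  assumes "inner_faithful scale \<Delta> \<epsilon> S act"
    and generated: "generated_by scaleA u v"
  shows "act x u \<noteq> 0 \<or> act x v \<noteq> 0"
proof (rule ccontr)
  assume zero: "\<not> ?thesis"
  have "act x a = 0" for a
    by (rule generated_by_induct[OF generated, where Q = "\<lambda>a. act x a = 0"])
      (use zero in \<open>simp_all add: act_unit counit_x act_x_mult act_right\<close>)
  with inner_faithful_generated[OF assms(1) hopf_ideal_x] x_neq_0 show False by blast
qed

lemma g_acts_with_order_n: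
  assumes "inner_faithful scale \<Delta> \<epsilon> S act"
    and generated: "generated_by scaleA u v"
    and gu: "act g u = scaleA \<alpha> u" and gv: "act g v = scaleA \<delta> v"
    and l: "\<alpha> ^ l = 1" "\<delta> ^ l = 1" "0 < l"
  shows "n \<le> l"
proof (rule ccontr)
  assume "\<not> n \<le> l"
  then have "g ^ l - 1 \<noteq> 0" using g_power_neq_1[of l] l by simp
  have mult: "act (g ^ j) (a * b) = act (g ^ j) a * act (g ^ j) b" for a b j
    by (induction j) (simp_all add: act_mult act_g_mult)
  have pow: "act (g ^ j) u = scaleA (\<alpha> ^ j) u" "act (g ^ j) v = scaleA (\<delta> ^ j) v" "act (g ^ j) 1 = 1" for j
    by (induction j) (simp_all add: act_mult gu gv act_right act_unit counit_g counit_one counit_mult mult.commute)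
  have "act (g ^ l) a = a" for a
    by (rule generated_by_induct[OF generated, where Q = "\<lambda>a. act (g ^ l) a = a"])
      (simp_all add: pow mult l act_right)
  then have "act (g ^ l - 1) a = 0" for a by (simp add: act_left)
  then have "g ^ l - 1 = 0" by (rule inner_faithful_generated[OF assms(1) hopf_ideal_g_power])
  with \<open>g ^ l - 1 \<noteq> 0\<close> show False ..
qed

text \<open>The coefficients at \<open>u\<^sup>2\<close>, \<open>v\<^sup>2\<close>, \<open>v u\<close> and \<open>1\<close> of the images of the defining relation under
  \<open>g\<close> and \<open>x\<close>, together with \<open>g x = \<lambda> x g\<close> on \<open>u\<close> and \<open>v\<close>, are equations for the matrices of
  \<open>g\<close> and \<open>x\<close>. As \<open>g\<close> is invertible, they leave it diagonal or, for \<open>\<mu> = -1\<close>, antidiagonal. In the diagonal case \<open>x\<close> is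
  antidiagonal, and exactly one of its entries is nonzero because \<open>x\<close> is nilpotent and does not
  act by zero. In the antidiagonal case \<open>\<lambda> = -1\<close>, so \<open>m = 2\<close>, but \<open>x\<^sup>2\<close> acts as a nonzero scalar.\<close>

lemma linear_inner_faithful_cases:
  assumes rel: "u * v = scaleA \<mu> (v * u) + scaleA e 1"
    and indep4: "\<And>p q r s. scaleA p (u * u) + scaleA q (v * v) + scaleA r (v * u) + scaleA s 1 = 0 \<Longrightarrow>
      p = 0 \<and> q = 0 \<and> r = 0 \<and> s = 0"
    and indep: "\<And>p q. scaleA p u + scaleA q v = 0 \<Longrightarrow> p = 0 \<and> q = 0"
    and generated: "generated_by scaleA u v"
    and \<mu>: "\<mu> \<noteq> 0" "\<mu> \<noteq> 1"
    and lin: "linear_action scaleA u v g x act" and faithful: "inner_faithful scale \<Delta> \<epsilon> S act"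
  shows "(\<exists>\<eta>. \<eta> \<noteq> 0 \<and> action_a \<mu> lam \<eta> scaleA u v g x act \<and> (e \<noteq> 0 \<longrightarrow> lam = \<mu>\<^sup>2)) \<or>
    (\<exists>\<eta>. \<eta> \<noteq> 0 \<and> action_b \<mu> lam \<eta> scaleA u v g x act \<and> (e \<noteq> 0 \<longrightarrow> lam = inverse (\<mu>\<^sup>2)))"
proof -
  \<comment> \<open>coordinates on the span of \<open>u\<close> and \<open>v\<close> and on that of the monomials of a product of two such elements\<close>
  define L where "L p q = scaleA p u + scaleA q v" for p q
  define N where "N p q r s = scaleA p (u * u) + scaleA q (v * v) + scaleA r (v * u) + scaleA s 1" for p q r s
  have L_eq: "p = p' \<and> q = q'" if "L p q = L p' q'" for p q p' q'
    using indep[of "p - p'" "q - q'"] that by (simp add: L_def A.scale_left_diff_distrib algebra_simps)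
  have N_eq: "p = p' \<and> q = q' \<and> r = r' \<and> s = s'" if "N p q r s = N p' q' r' s'" for p q r s p' q' r' s'
    using indep4[of "p - p'" "q - q'" "r - r'" "s - s'"] that
    by (simp add: N_def A.scale_left_diff_distrib algebra_simps)
  have L_mult: "L a b * L c d = N (a * c) (b * d) (a * d * \<mu> + b * c) (a * d * e)" for a b c d
    by (simp add: L_def N_def distrib_left distrib_right A.scale_mult_left[symmetric]
        A.scale_mult_right[symmetric] rel A.scale_right_distrib A.scale_left_distrib algebra_simps)
  have N_add: "N p q r s + N p' q' r' s' = N (p + p') (q + q') (r + r') (s + s')" for p q r s p' q' r' s'
    by (simp add: N_def A.scale_left_distrib algebra_simps)
  have N_scale: "scaleA t (N p q r s) = N (t * p) (t * q) (t * r) (t * s)" for t p q r s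
    by (simp add: N_def A.scale_right_distrib)
  have N_one: "scaleA t 1 = N 0 0 0 t" for t by (simp add: N_def)
  have L_uv: "u = L 1 0" "v = L 0 1" "0 = L 0 0" by (simp_all add: L_def)
  have L_span: "\<exists>p q. w = L p q" if w: "w \<in> A.span {u, v}" for w
  proof -
    obtain p where "w - scaleA p u \<in> A.span {v}" using w A.span_breakdown_eq[of w u "{v}"] by blast
    then obtain q where "w - scaleA p u = scaleA q v" unfolding A.span_singleton by blast
    then have "w = L p q" by (simp add: L_def algebra_simps)
    then show ?thesis by blast
  qed
  have uv: "u \<in> A.span {u, v}" "v \<in> A.span {u, v}" by (auto intro: A.span_base)
  obtain a b c d p q r s where gu: "act g u = L a b" and gv: "act g v = L c d"
    and xu: "act x u = L p q" and xv: "act x v = L r s"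
    using lin uv L_span unfolding linear_action_def by (metis image_subset_iff)
  have gL: "act g (L i j) = L (i * a + j * c) (i * b + j * d)" for i j
    unfolding L_def[of i j] by (simp add: act_right gu gv L_def A.scale_left_distrib A.scale_right_distrib algebra_simps)
  have xL: "act x (L i j) = L (i * p + j * r) (i * q + j * s)" for i j
    unfolding L_def[of i j] by (simp add: act_right xu xv L_def A.scale_left_distrib A.scale_right_distrib algebra_simps)
  have "act g u * act g v = scaleA \<mu> (act g v * act g u) + scaleA e 1"
    using arg_cong[OF rel, of "act g"] by (simp add: act_right act_g_mult act_unit counit_g)
  then have "N (a * c) (b * d) (a * d * \<mu> + b * c) (a * d * e) =
      N (\<mu> * (c * a)) (\<mu> * (d * b)) (\<mu> * (c * b * \<mu> + d * a)) (\<mu> * (c * b * e) + e)"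
    by (simp add: gu gv L_mult N_scale N_add N_one)
  from N_eq[OF this] have g1: "a * c = \<mu> * (c * a)" and g2: "b * d = \<mu> * (d * b)"
    and g3: "a * d * \<mu> + b * c = \<mu> * (c * b * \<mu> + d * a)" and g4: "a * d * e = \<mu> * (c * b * e) + e" by auto
  have "act g u * act x v + act x u * v = scaleA \<mu> (act g v * act x u + act x v * u)"
    using arg_cong[OF rel, of "act x"] by (simp add: act_right act_x_mult act_unit counit_x)
  then have "L a b * L r s + L p q * L 0 1 = scaleA \<mu> (L c d * L p q + L r s * L 1 0)"
    using L_uv gu gv xu xv by simp
  then have "N (a * r) (b * s + q) (a * s * \<mu> + b * r + p * \<mu>) (a * s * e + p * e) =
      N (\<mu> * (c * p + r)) (\<mu> * (d * q)) (\<mu> * (c * q * \<mu> + d * p + s)) (\<mu> * (c * q * e))"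
    by (simp add: L_mult N_scale N_add)
  from N_eq[OF this] have x1: "a * r = \<mu> * (c * p + r)" and x2: "b * s + q = \<mu> * (d * q)"
    and x3: "a * s * \<mu> + b * r + p * \<mu> = \<mu> * (c * q * \<mu> + d * p + s)" by auto
  have gx: "act g (act x w) = scaleA lam (act x (act g w))" for w
    using g_x by (metis act_mult act_left(2))
  have L_scale: "scaleA t (L i j) = L (t * i) (t * j)" for t i j by (simp add: L_def A.scale_right_distrib)
  have "L (p * a + q * c) (p * b + q * d) = L (lam * (a * p + b * r)) (lam * (a * q + b * s))"
    using gx[of u] by (simp add: gu xu gL xL L_scale)
  from L_eq[OF this] have c1: "p * a + q * c = lam * (a * p + b * r)" and c2: "p * b + q * d = lam * (a * q + b * s)" by auto
  have "L (r * a + s * c) (r * b + s * d) = L (lam * (c * p + d * r)) (lam * (c * q + d * s))"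
    using gx[of v] by (simp add: gv xv gL xL L_scale)
  from L_eq[OF this] have c3: "r * a + s * c = lam * (c * p + d * r)" and c4: "r * b + s * d = lam * (c * q + d * s)" by auto
  have not0: "u \<noteq> 0" "v \<noteq> 0" using indep[of 1 0] indep[of 0 1] by auto
  have gn: "w = 0" if "act g w = 0" for w
  proof -
    have "act (g ^ n) w = act (g ^ (n - 1)) (act g w)"
      using n_pos by (simp flip: act_mult power_Suc2)
    then show ?thesis using that g_power_n by (simp add: act_right)
  qed
  have ab: "a \<noteq> 0 \<or> b \<noteq> 0" using gn[of u] not0 gu L_uv(3) by auto
  have cd: "c \<noteq> 0 \<or> d \<noteq> 0" using gn[of v] not0 gv L_uv(3) by auto
  have pqrs: "p \<noteq> 0 \<or> q \<noteq> 0 \<or> r \<noteq> 0 \<or> s \<noteq> 0"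
    using x_acts_nontrivially[OF faithful generated] xu xv L_uv(3) by auto
  have xm: "(act x ^^ m) w = 0" for w
    using x_power_m by (simp add: act_power[symmetric] act_left)
  have ac0: "a * c = 0" and bd0: "b * d = 0" using g1 g2 \<mu>(2) by (auto simp: mult.commute)
  show ?thesis
  proof (cases "a = 0")
    case False
    then have c0: "c = 0" using ac0 by simp
    then have d0: "d \<noteq> 0" using cd by simp
    then have b0: "b = 0" using bd0 by simp
    have p0: "p = 0" using c1 False lam_neq_1 c0 b0 by auto
    have s0: "s = 0" using c4 d0 lam_neq_1 c0 b0 by auto
    have xx: "act x u = scaleA q v" "act x v = scaleA r u" using xu xv p0 s0 by (simp_all add: L_def)
    have gg: "act g u = scaleA a u" "act g v = scaleA d v" using gu gv b0 c0 by (simp_all add: L_def)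
    have ad: "e \<noteq> 0 \<Longrightarrow> a * d = 1" using g4 c0 by simp
    have "q = 0 \<or> r = 0"
    proof (rule ccontr)
      assume qr: "\<not> ?thesis"
      have "(act x ^^ (2 * j)) u = scaleA ((q * r) ^ j) u" for j
        by (induction j) (simp_all add: xx act_right mult_ac)
      then have "scaleA ((q * r) ^ m) u = act (x ^ (2 * m)) u" by (simp add: act_power)
      also have "\<dots> = 0" using x_power_m by (simp add: power_mult[symmetric] mult.commute[of 2] power_mult act_left)
      finally show False using qr not0 by simp
    qed
    then consider "r \<noteq> 0" "q = 0" | "r = 0" "q \<noteq> 0" using pqrs p0 s0 by blast
    then show ?thesis
    proof cases
      case 1
      have a: "a = \<mu>" using x1 1 c0 by simp
      have "a = lam * d" using c3 1 c0 s0 by simp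
      then have d: "d = inverse lam * \<mu>" using lam_neq_0 a by simp
      have "lam = \<mu>\<^sup>2" if "e \<noteq> 0" using ad[OF that] lam_neq_0 by (simp add: a d field_simps power2_eq_square)
      then show ?thesis using 1 gg xx a d unfolding action_a_def by (intro disjI1 exI[of _ r]) simp
    next
      case 2
      have "\<mu> * d = 1" using x2 2 s0 by simp
      then have d: "d = inverse \<mu>" by (metis inverse_unique)
      have "d = lam * a" using c2 2 p0 b0 by simp
      then have a: "a = inverse lam * inverse \<mu>" using lam_neq_0 d by (simp add: field_simps)
      have "lam = inverse (\<mu>\<^sup>2)" if "e \<noteq> 0"
        using ad[OF that] lam_neq_0 \<mu> by (simp add: a d field_simps power2_eq_square)
      then show ?thesis using 2 gg xx a d unfolding action_b_def by (intro disjI2 exI[of _ q]) simp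
    qed
  next
    case a0: True
    then have b: "b \<noteq> 0" using ab by simp
    then have d0: "d = 0" using bd0 by simp
    then have c: "c \<noteq> 0" using cd by simp
    have "b * c * (\<mu> * \<mu>) = b * c" using g3 a0 d0 by (simp add: mult_ac)
    then have "\<mu> * \<mu> = 1" using b c by simp
    then have \<mu>': "\<mu> = - 1" using \<mu>(2) square_eq_1_iff by blast
    have r: "r = - (c * p)" using x1 a0 \<mu>(1) by (simp add: eq_neg_iff_add_eq_0 add.commute)
    have q: "q = - (b * s)" using x2 d0 by (simp add: eq_neg_iff_add_eq_0 add.commute)
    have ps: "p = lam * s" using c2 a0 d0 b by (simp add: mult_ac)
    have sp: "s = lam * p" using c3 a0 d0 c by (simp add: mult_ac)
    have p: "p \<noteq> 0" using pqrs r q sp by auto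
    have "lam * lam * p = p" using ps sp by (simp add: mult.assoc)
    then have lam2: "lam * lam = 1" using p by simp
    then have lam': "lam = - 1" using lam_neq_1 square_eq_1_iff by blast
    have m2: "m = 2"
      using lam2 lam_power_eq_1_iff[of 2] m_ge_2 by (auto simp: power2_eq_square dest: dvd_imp_le)
    have s': "s = - p" using sp lam' by simp
    have two: "(2 :: 'k) \<noteq> 0"
    proof
      assume "(2 :: 'k) = 0"
      then have "(1 :: 'k) = - 1" by (metis add.inverse_inverse add_eq_0_iff one_add_one)
      then show False using \<mu>' \<mu>(2) by simp
    qed
    have "b * r - p = c * q - s" using x3 a0 d0 \<mu>' by (simp add: algebra_simps)
    then have "2 * p * (b * c + 1) = 0" unfolding r q s' by (simp add: algebra_simps)
    then have bc: "b * c = - 1" using two p by (simp add: eq_neg_iff_add_eq_0)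
    have "act x (act x u) = 0" using xm[of u] m2 by (simp add: numeral_2_eq_2)
    then have "L (p * p + q * r) (p * q + q * s) = L 0 0" by (simp add: xu xL L_uv(3)[symmetric])
    then have "p * p + q * r = 0" using L_eq by blast
    moreover have "q * r = - (p * p) * (b * c)" unfolding q r s' by (simp add: algebra_simps)
    ultimately have "2 * (p * p) = 0" using bc by simp
    then show ?thesis using two p by simp
  qed
qed

end

section \<open>The quantum plane and the first quantum Weyl algebra\<close>

text \<open>The constant \<open>e\<close> covers both algebras: \<open>e = 0\<close> gives the quantum plane and \<open>e = 1\<close> the first quantum
  Weyl algebra.\<close>

definition quantum_relation :: "'k::field \<Rightarrow> 'k \<Rightarrow> (gen word \<Rightarrow>\<^sub>0 'k)" where
  "quantum_relation \<mu> e = free_gen Gen1 * free_gen Gen2 - fscale \<mu> (free_gen Gen2 * free_gen Gen1) - fscale e 1"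

locale quantum_algebra = k_algebra scale
  for scale :: "'k::field \<Rightarrow> 'a::ring_1 \<Rightarrow> 'a" +
  fixes \<mu> e :: 'k and u v :: 'a
  assumes presented: "presented_by scale (case_gen u v) {quantum_relation \<mu> e}"
begin

lemma relation: "u * v = scale \<mu> (v * u) + scale e 1"
  using presented_relation[OF presented, of "quantum_relation \<mu> e"]
  by (simp add: quantum_relation_def algebra_simps)

lemma generated: "generated_by scale u v" "generated_by scale v u"
proof -
  have gen: "Q a" if Q: "Q 1" "\<And>a. Q a \<Longrightarrow> Q (u * a)" "\<And>a. Q a \<Longrightarrow> Q (v * a)"
    "\<And>a b. Q a \<Longrightarrow> Q b \<Longrightarrow> Q (a + b)" "\<And>c a. Q a \<Longrightarrow> Q (scale c a)" for Q and a :: 'a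
    using presented
  proof (induction a rule: presented_induct)
    case (gen i a) then show ?case using Q(2,3) by (cases i) simp_all
  qed (use Q in auto)
  show "generated_by scale u v"
    unfolding generated_by_def
  proof (intro allI impI)
    fix Q and a :: 'a
    assume "Q 1" "\<forall>a. Q a \<longrightarrow> Q (u * a) \<and> Q (v * a)" "\<forall>a b. Q a \<longrightarrow> Q b \<longrightarrow> Q (a + b)"
      "\<forall>c a. Q a \<longrightarrow> Q (scale c a)"
    then show "Q a" by (intro gen[of Q a]) simp_all
  qed
  show "generated_by scale v u"
    unfolding generated_by_def
  proof (intro allI impI)
    fix Q and a :: 'a
    assume "Q 1" "\<forall>a. Q a \<longrightarrow> Q (v * a) \<and> Q (u * a)" "\<forall>a b. Q a \<longrightarrow> Q b \<longrightarrow> Q (a + b)"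
      "\<forall>c a. Q a \<longrightarrow> Q (scale c a)"
    then show "Q a" by (intro gen[of Q a]) simp_all
  qed
qed

lemma quantum_rep:
  assumes W: "vector_space scaleW" and Y: "Vector_Spaces.linear scaleW scaleW Y"
    and Z: "Vector_Spaces.linear scaleW scaleW Z"
    and YZ: "\<And>w. Y (Z w) = scaleW \<mu> (Z (Y w)) + scaleW e w"
  obtains \<rho> where "\<And>w. Vector_Spaces.linear scale scaleW (\<lambda>a. \<rho> a w)"
    "\<And>w. \<rho> 1 w = w" "\<And>a b w. \<rho> (a * b) w = \<rho> a (\<rho> b w)" "\<rho> u = Y" "\<rho> v = Z"
proof -
  interpret W: vector_space scaleW by fact
  have E: "Vector_Spaces.linear scaleW scaleW (case_gen Y Z i)" for i
    using Y Z by (cases i) simp_all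
  have R: "free_act scaleW (case_gen Y Z) r w = 0" if "r \<in> {quantum_relation \<mu> e}" for r w
    using that YZ by (simp add: E quantum_relation_def)
  obtain \<rho> where \<rho>: "\<And>w. Vector_Spaces.linear scale scaleW (\<lambda>a. \<rho> a w)"
    "\<And>a. Vector_Spaces.linear scaleW scaleW (\<rho> a)"
    "\<And>w. \<rho> 1 w = w" "\<And>a b w. \<rho> (a * b) w = \<rho> a (\<rho> b w)"
    "\<And>i w. \<rho> (case_gen u v i) w = case_gen Y Z i w"
    by (rule presented_rep[OF presented W E R], assumption) (rule that; assumption)
  have "\<rho> u = Y" "\<rho> v = Z" using \<rho>(5)[of Gen1] \<rho>(5)[of Gen2] by auto
  then show thesis using that[of \<rho>] \<rho>(1-4) by blast
qed

text \<open>The regular representation in the basis \<open>v\<^sup>i u\<^sup>j\<close>, in which \<open>u\<close> moves past \<open>v\<^sup>i\<close> by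
  \<open>u v\<^sup>i = \<mu>\<^sup>i v\<^sup>i u + e (1 + \<mu> + \<dots> + \<mu>\<^sup>i\<^sup>-\<^sup>1) v\<^sup>i\<^sup>-\<^sup>1\<close>, separates the monomials of degree at most two.\<close>

lemma monomials_independent:
  shows "scale p u + scale q v = 0 \<Longrightarrow> p = 0 \<and> q = 0"
    and "scale p (u * u) + scale q (v * v) + scale r (v * u) + scale s 1 = 0 \<Longrightarrow> p = 0 \<and> q = 0 \<and> r = 0 \<and> s = 0"
proof -
  define Y :: "(nat \<times> nat \<Rightarrow>\<^sub>0 'k) \<Rightarrow> (nat \<times> nat \<Rightarrow>\<^sub>0 'k)" where
    "Y = lin_ext fscale (\<lambda>p. fscale (\<mu> ^ fst p) (basis_vec (fst p, Suc (snd p))) +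
       fscale (e * (\<Sum>s<fst p. \<mu> ^ s)) (basis_vec (fst p - 1, snd p)))"
  define Z :: "(nat \<times> nat \<Rightarrow>\<^sub>0 'k) \<Rightarrow> (nat \<times> nat \<Rightarrow>\<^sub>0 'k)" where
    "Z = lin_ext fscale (\<lambda>p. basis_vec (Suc (fst p), snd p))"
  have Y: "Vector_Spaces.linear fscale fscale Y" and Z: "Vector_Spaces.linear fscale fscale Z"
    unfolding Y_def Z_def by (rule formal.linear_lin_ext)+
  have YZ: "Y (Z w) = fscale \<mu> (Z (Y w)) + fscale e w" for w
  proof (induction w rule: formal_induct)
    case (basis c p)
    obtain i j where p: "p = (i, j)" by (cases p)
    have "Y (Z (basis_vec p)) = fscale \<mu> (Z (Y (basis_vec p))) + fscale e (basis_vec p)"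
    proof (cases i)
      case 0 then show ?thesis by (simp add: p Y_def Z_def)
    next
      case (Suc i')
      have "e * (\<Sum>s<Suc i. \<mu> ^ s) = e + \<mu> * (e * (\<Sum>s<i. \<mu> ^ s))"
        unfolding sum.lessThan_Suc_shift by (simp add: algebra_simps sum_distrib_left)
      then show ?thesis
        by (simp add: p Y_def Z_def Suc formal.scale_right_distrib formal.scale_left_distrib
            del: sum.lessThan_Suc)
    qed
    then have "fscale c (Y (Z (basis_vec p))) = fscale c (fscale \<mu> (Z (Y (basis_vec p))) + fscale e (basis_vec p))" by simp
    then show ?case
      by (simp add: Y_def Z_def formal.scale_right_distrib mult_ac)
  next
    case (add s t)
    then show ?case by (simp add: Y_def Z_def formal.scale_right_distrib algebra_simps)
  qed
  obtain \<rho> where \<rho>: "\<And>w. Vector_Spaces.linear scale fscale (\<lambda>a. \<rho> a w)"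
    "\<And>w. \<rho> 1 w = w" "\<And>a b w. \<rho> (a * b) w = \<rho> a (\<rho> b w)" "\<rho> u = Y" "\<rho> v = Z"
    by (rule quantum_rep[OF formal.vector_space_axioms Y Z YZ]) (rule that; assumption)
  interpret \<rho>: Vector_Spaces.linear scale fscale "\<lambda>a. \<rho> a (basis_vec (0, 0))" by (rule \<rho>(1))
  have YZ_vals: "Y (basis_vec (0, j)) = basis_vec (0, Suc j)" "Z (basis_vec (i, j)) = basis_vec (Suc i, j)" for i j
    by (simp_all add: Y_def Z_def)
  show "p = 0 \<and> q = 0" if "scale p u + scale q v = 0"
  proof -
    have "fscale p (basis_vec (0, 1)) + fscale q (basis_vec (1, 0)) = (0 :: nat \<times> nat \<Rightarrow>\<^sub>0 'k)"
      using arg_cong[OF that, of "\<lambda>a. \<rho> a (basis_vec (0, 0))"]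
      by (simp only: \<rho>.add \<rho>.scale \<rho>.zero) (simp add: \<rho> YZ_vals)
    from arg_cong[OF this, of "\<lambda>t. Poly_Mapping.lookup t w" for w]
    have *: "p * Poly_Mapping.lookup (basis_vec (0, 1)) w + q * Poly_Mapping.lookup (basis_vec (1, 0)) w = 0" for w :: "nat \<times> nat"
      by (simp only: lookup_add lookup_fscale lookup_zero)
    show ?thesis using *[of "(0, 1)"] *[of "(1, 0)"] by (simp add: basis_vec_def lookup_single)
  qed
  show "p = 0 \<and> q = 0 \<and> r = 0 \<and> s = 0"
    if "scale p (u * u) + scale q (v * v) + scale r (v * u) + scale s 1 = 0"
  proof -
    have "fscale p (basis_vec (0, 2)) + fscale q (basis_vec (2, 0)) + fscale r (basis_vec (1, 1)) + fscale s (basis_vec (0, 0))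
      = (0 :: nat \<times> nat \<Rightarrow>\<^sub>0 'k)"
      using arg_cong[OF that, of "\<lambda>a. \<rho> a (basis_vec (0, 0))"]
      by (simp only: \<rho>.add \<rho>.scale \<rho>.zero) (simp add: \<rho> YZ_vals numeral_2_eq_2)
    from arg_cong[OF this, of "\<lambda>t. Poly_Mapping.lookup t w" for w]
    have *: "p * Poly_Mapping.lookup (basis_vec (0, 2)) w + q * Poly_Mapping.lookup (basis_vec (2, 0)) w +
      r * Poly_Mapping.lookup (basis_vec (1, 1)) w + s * Poly_Mapping.lookup (basis_vec (0, 0)) w = 0" for w :: "nat \<times> nat"
      by (simp only: lookup_add lookup_fscale lookup_zero)
    show ?thesis using *[of "(0, 2)"] *[of "(2, 0)"] *[of "(1, 1)"] *[of "(0, 0)"]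
      by (simp add: basis_vec_def lookup_single)
  qed
qed

end

section \<open>Existence of the actions\<close>

text \<open>Since \<open>\<Delta>\<close> is multiplicative, the product formula for \<open>h\<close> and \<open>h'\<close> implies that for \<open>h h'\<close>. It is the
  endomorphism property for \<open>g\<close> and the skew Leibniz rule for \<open>x\<close>.\<close>

lemma (in taft) module_algebra_from_generators:
  assumes A: "k_algebra scaleA"
    and lin1: "\<And>a. Vector_Spaces.linear scale scaleA (\<lambda>h. act h a)"
    and lin2: "\<And>h. Vector_Spaces.linear scaleA scaleA (act h)"
    and one: "\<And>a. act 1 a = a" and mult: "\<And>h h' a. act (h * h') a = act h (act h' a)"
    and g1: "act g 1 = 1" and x1: "act x 1 = 0"
    and g_mult: "\<And>a b. act g (a * b) = act g a * act g b"
    and x_mult: "\<And>a b. act x (a * b) = act g a * act x b + act x a * b"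
  shows "module_algebra scale \<Delta> \<epsilon> scaleA act"
proof -
  interpret A: k_algebra scaleA by fact
  have left: "act (h + h') a = act h a + act h' a" "act (scale c h) a = scaleA c (act h a)" for h h' a c
    using lin1[of a] by (simp_all add: Vector_Spaces.linear_iff)
  have right: "act h (a + b) = act h a + act h b" "act h (scaleA c a) = scaleA c (act h a)" "act h 0 = 0" for h a b c
  proof -
    interpret r: Vector_Spaces.linear scaleA scaleA "act h" by (rule lin2)
    show "act h (a + b) = act h a + act h b" "act h (scaleA c a) = scaleA c (act h a)" "act h 0 = 0"
      by (rule r.add r.scale r.zero)+
  qed
  have unit: "act h 1 = scaleA (\<epsilon> h) 1" for h
    by (induction h rule: taft_induct)
      (simp_all add: one mult g1 x1 counit_one counit_mult counit_g counit_x left right linear_counit A.scale_left_distrib)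
  have bil: "bilinear_pair scale scaleA (\<lambda>(h1, h2). act h1 a * act h2 b)" for a b
    by (simp add: bilinear_pair_def Vector_Spaces.linear_iff vector_space_axioms A.vector_space_axioms left
        distrib_left distrib_right A.scale_mult_left[symmetric] A.scale_mult_right[symmetric])
  define Q where "Q h \<longleftrightarrow> (\<forall>a b. act h (a * b) = lin_ext scaleA (\<lambda>(h1, h2). act h1 a * act h2 b) (\<Delta> h))" for h
  have Q_mult: "Q (h * h')" if "Q h" "Q h'" for h h'
    unfolding Q_def
  proof (intro allI)
    fix a b
    have "act (h * h') (a * b) = act h (lin_ext scaleA (\<lambda>(h1, h2). act h1 a * act h2 b) (\<Delta> h'))"
      using that(2) by (simp add: mult Q_def)
    also have "\<dots> = lin_ext scaleA (\<lambda>q. act h (act (fst q) a * act (snd q) b)) (\<Delta> h')"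
      by (simp add: A.lin_ext_comp[OF lin2] split_def)
    also have "\<dots> = lin_ext scaleA (\<lambda>q. lin_ext scaleA (\<lambda>p. act (fst p * fst q) a * act (snd p * snd q) b) (\<Delta> h)) (\<Delta> h')"
      using that(1) by (simp add: Q_def mult split_def)
    also have "\<dots> = lin_ext scaleA (\<lambda>p. lin_ext scaleA (\<lambda>q. act (fst p * fst q) a * act (snd p * snd q) b) (\<Delta> h')) (\<Delta> h)"
      by (rule lin_ext_swap[OF A.vector_space_axioms])
    also have "\<dots> = lin_ext scaleA (\<lambda>(h1, h2). act h1 a * act h2 b) (\<Delta> (h * h'))"
      unfolding comult_lin_ext(4)[OF bil] by (simp add: split_def)
    finally show "act (h * h') (a * b) = lin_ext scaleA (\<lambda>(h1, h2). act h1 a * act h2 b) (\<Delta> (h * h'))" .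
  qed
  have Q_g: "Q g" by (simp add: Q_def tensor2_eq_lin_ext[OF comult_g bil] g_mult)
  have Q_x: "Q x" by (simp add: Q_def tensor2_eq_lin_ext[OF comult_x bil] x_mult one)
  have "Q h" for h
  proof (induction h rule: taft_induct)
    case one show ?case by (simp add: Q_def comult_lin_ext(3)[OF bil] assms(4))
  next
    case (g a) then show ?case by (rule Q_mult[OF Q_g])
  next
    case (x a) then show ?case by (rule Q_mult[OF Q_x])
  next
    case (add a b) then show ?case by (simp add: Q_def comult_lin_ext(1)[OF bil] left)
  next
    case (scale c a) then show ?case by (simp add: Q_def comult_lin_ext(2)[OF bil] left)
  qed
  then show ?thesis
    unfolding module_algebra_def using lin1 lin2 one mult unit by (auto simp: Q_def)
qed

text \<open>The module structure \<open>\<rho>\<close> on \<open>A \<times> A\<close> is the algebra homomorphism from \<open>A\<close> to upper triangular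
  matrices over \<open>A\<close> with first row \<open>(G a, X a)\<close> and second row \<open>(0, a)\<close>: its multiplicativity says that
  \<open>G\<close> is an endomorphism and \<open>X\<close> a skew derivation. Nilpotency of \<open>X\<close> comes down to the vanishing of
  \<open>1 + \<lambda>\<^sup>-\<^sup>1 + \<dots> + (\<lambda>\<^sup>-\<^sup>1)\<^sup>m\<^sup>-\<^sup>1\<close>, which is the only coefficient left in \<open>X\<^sup>m (z a)\<close> if \<open>X\<^sup>m a = 0\<close>.\<close>

lemma (in taft) triangular_action_exists:
  assumes A: "k_algebra scaleA" and gen: "generated_by scaleA y z"
    and lin: "\<And>w. Vector_Spaces.linear scaleA (pair_scale scaleA) (\<lambda>a. \<rho> a w)"
    and \<rho>_one: "\<And>w. \<rho> 1 w = w" and \<rho>_mult: "\<And>a b w. \<rho> (a * b) w = \<rho> a (\<rho> b w)"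
    and \<rho>_y: "\<And>b c. \<rho> y (b, c) = (scaleA \<alpha> (y * b), y * c)"
    and \<rho>_z: "\<And>b c. \<rho> z (b, c) = (scaleA \<delta> (z * b) + scaleA \<eta> (y * c), z * c)"
    and \<alpha>\<delta>: "\<alpha> = lam * \<delta>" and \<alpha>n: "\<alpha> ^ n = 1" and \<delta>n: "\<delta> ^ n = 1"
  shows "\<exists>act. module_algebra scale \<Delta> \<epsilon> scaleA act \<and> act g y = scaleA \<alpha> y \<and> act g z = scaleA \<delta> z \<and>
    act x y = 0 \<and> act x z = scaleA \<eta> y"
proof -
  interpret A: k_algebra scaleA by fact
  define G where "G a = fst (\<rho> a (1, 0))" for a
  define X where "X a = fst (\<rho> a (0, 1))" for a
  have \<rho>_add: "\<rho> (a + b) w = \<rho> a w + \<rho> b w" and \<rho>_scale: "\<rho> (scaleA c a) w = pair_scale scaleA c (\<rho> a w)" for a b w c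
    using lin[of w] by (simp_all add: Vector_Spaces.linear_iff)
  have "\<forall>b c. \<rho> a (b, c) = (G a * b + X a * c, a * c)" for a
    using gen
  proof (induction a rule: generated_by_induct)
    case one then show ?case by (simp add: G_def[of 1] X_def[of 1] \<rho>_one)
  next
    case (left a)
    then show ?case
      by (simp add: G_def[of "y * a"] X_def[of "y * a"] \<rho>_mult \<rho>_y mult.assoc distrib_left A.scale_right_distrib A.scale_mult_left[symmetric])
  next
    case (right a)
    then show ?case
      by (simp add: G_def[of "z * a"] X_def[of "z * a"] \<rho>_mult \<rho>_z mult.assoc distrib_left distrib_right A.scale_right_distrib A.scale_mult_left[symmetric])
  next
    case (add a b)
    then show ?case by (simp add: G_def[of "a + b"] X_def[of "a + b"] \<rho>_add plus_prod_def distrib_right algebra_simps)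
  next
    case (scale c a)
    then show ?case by (simp add: G_def[of "scaleA c a"] X_def[of "scaleA c a"] \<rho>_scale pair_scale_def A.scale_mult_left[symmetric] A.scale_right_distrib)
  qed
  then have \<rho>: "\<rho> a (b, c) = (G a * b + X a * c, a * c)" for a b c by blast
  have G_mult: "G (a * b) = G a * G b" and X_mult: "X (a * b) = G a * X b + X a * b" for a b
    unfolding G_def[of "a * b"] X_def[of "a * b"] \<rho>_mult by (simp_all add: \<rho>)
  have G_lin: "G (a + b) = G a + G b" "G (scaleA c a) = scaleA c (G a)"
    and X_lin: "X (a + b) = X a + X b" "X (scaleA c a) = scaleA c (X a)" for a b c
    by (simp_all add: G_def X_def \<rho>_add \<rho>_scale pair_scale_def)
  have vals: "G 1 = 1" "X 1 = 0" "G y = scaleA \<alpha> y" "X y = 0" "G z = scaleA \<delta> z" "X z = scaleA \<eta> y"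
    by (simp_all add: G_def X_def \<rho>_one \<rho>_y \<rho>_z)
  have zero: "G 0 = 0" "X 0 = 0" using G_lin(2)[of 0 0] X_lin(2)[of 0 0] by simp_all
  have Gj: "(G ^^ j) (a * b) = (G ^^ j) a * (G ^^ j) b" "(G ^^ j) (a + b) = (G ^^ j) a + (G ^^ j) b"
    "(G ^^ j) (scaleA c a) = scaleA c ((G ^^ j) a)" "(G ^^ j) 1 = 1"
    "(G ^^ j) y = scaleA (\<alpha> ^ j) y" "(G ^^ j) z = scaleA (\<delta> ^ j) z" for j a b c
    by (induction j) (simp_all add: G_mult G_lin vals mult.commute)
  have Gn: "(G ^^ n) a = a" for a
    using gen by (induction a rule: generated_by_induct) (simp_all add: Gj \<alpha>n \<delta>n)
  have Xj: "(X ^^ j) (a + b) = (X ^^ j) a + (X ^^ j) b" "(X ^^ j) (scaleA c a) = scaleA c ((X ^^ j) a)"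
    "(X ^^ j) 0 = 0" for j a b c
    by (induction j) (simp_all add: X_lin zero)
  have Xj_y: "(X ^^ j) (y * a) = scaleA (\<alpha> ^ j) (y * (X ^^ j) a)" for j a
    by (induction j) (simp_all add: X_lin X_mult vals A.scale_mult_left[symmetric] mult.commute)
  have \<delta>: "\<delta> = inverse lam * \<alpha>" using lam_neq_0 \<alpha>\<delta> by simp
  have Xj_z: "(X ^^ Suc j) (z * a) = scaleA (\<delta> ^ Suc j) (z * (X ^^ Suc j) a) +
      scaleA (\<eta> * \<alpha> ^ j * (\<Sum>s\<le>j. inverse lam ^ s)) (y * (X ^^ j) a)" for j a
  proof (induction j)
    case 0 show ?case by (simp add: X_mult vals A.scale_mult_left[symmetric])
  next
    case (Suc j)
    let ?c = "\<eta> * \<alpha> ^ j * (\<Sum>s\<le>j. inverse lam ^ s)"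
    have "(X ^^ Suc (Suc j)) (z * a) = X (scaleA (\<delta> ^ Suc j) (z * (X ^^ Suc j) a) + scaleA ?c (y * (X ^^ j) a))"
      using Suc by simp
    also have "\<dots> = scaleA (\<delta> ^ Suc (Suc j)) (z * (X ^^ Suc (Suc j)) a) +
        scaleA (\<delta> ^ Suc j * \<eta> + ?c * \<alpha>) (y * (X ^^ Suc j) a)"
      by (simp add: X_lin X_mult vals A.scale_mult_left[symmetric] A.scale_right_distrib A.scale_left_distrib mult_ac)
    also have "\<delta> ^ Suc j * \<eta> + ?c * \<alpha> = \<eta> * \<alpha> ^ Suc j * (\<Sum>s\<le>Suc j. inverse lam ^ s)"
      unfolding \<delta> by (simp add: algebra_simps)
    finally show ?case .
  qed
  obtain m' where m': "m = Suc m'" using m_ge_2 by (cases m) auto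
  have geom: "(\<Sum>s\<le>m'. inverse lam ^ s) = 0"
  proof -
    have "(1 - inverse lam) * (\<Sum>s\<le>m'. inverse lam ^ s) = 1 - inverse lam ^ m"
      unfolding sum_gp_basic m' ..
    also have "\<dots> = 0" using lam_power_eq_1_iff[of m] by (simp add: power_inverse)
    finally show ?thesis using lam_neq_1 by (auto simp: inverse_eq_1_iff)
  qed
  have Xm: "(X ^^ m) a = 0" for a
    using gen
  proof (induction a rule: generated_by_induct)
    case one show ?case by (simp add: m' funpow_swap1 vals Xj)
  next
    case (left a) then show ?case by (simp add: Xj_y)
  next
    case (right a)
    then show ?case unfolding m' Xj_z geom by simp
  qed (simp_all add: Xj)
  have GX: "G (X a) = scaleA lam (X (G a))" for a
    using gen
  proof (induction a rule: generated_by_induct)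
    case one show ?case by (simp add: vals zero)
  next
    case (left a)
    then show ?case
      by (simp add: G_mult X_mult G_lin X_lin vals zero A.scale_mult_left[symmetric] A.scale_mult_right[symmetric] mult_ac)
  next
    case (right a)
    then show ?case
      by (simp add: G_mult X_mult G_lin X_lin vals zero A.scale_mult_left[symmetric] A.scale_mult_right[symmetric]
          A.scale_right_distrib \<alpha>\<delta> mult_ac)
  next
    case (add a b) then show ?case by (simp add: G_lin X_lin A.scale_right_distrib)
  next
    case (scale c a) then show ?case by (simp add: G_lin X_lin mult.commute)
  qed
  have "Vector_Spaces.linear scaleA scaleA G" "Vector_Spaces.linear scaleA scaleA X"
    by (simp_all add: Vector_Spaces.linear_iff A.vector_space_axioms G_lin X_lin)
  then obtain act where act: "\<And>a. Vector_Spaces.linear scale scaleA (\<lambda>h. act h a)"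
    "\<And>h. Vector_Spaces.linear scaleA scaleA (act h)"
    "\<And>a. act 1 a = a" "\<And>h h' a. act (h * h') a = act h (act h' a)" "act g = G" "act x = X"
    by (rule taft_rep[OF A.vector_space_axioms _ _ Gn Xm GX]) (rule that; assumption)
  have "module_algebra scale \<Delta> \<epsilon> scaleA act"
    by (rule module_algebra_from_generators[OF A act(1-4)]) (simp_all add: act(5,6) vals G_mult X_mult)
  then show ?thesis using act(5,6) vals by auto
qed

section \<open>The classification\<close>

lemma power_eq_1_iff_mult_order_dvd:
  assumes "mult_order a > 0"
  shows "a ^ j = 1 \<longleftrightarrow> mult_order a dvd j"
proof -
  have ex: "\<exists>j. 0 < j \<and> a ^ j = 1" using assms by (auto simp: mult_order_def split: if_splits)
  then have eq: "mult_order a = (LEAST j. 0 < j \<and> a ^ j = 1)" by (auto simp: mult_order_def)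
  have 1: "a ^ mult_order a = 1" unfolding eq using LeastI_ex[OF ex] by blast
  have split: "a ^ j = a ^ (j mod mult_order a)"
    using 1 by (subst div_mult_mod_eq[of j "mult_order a", symmetric], subst power_add) (simp add: power_mult mult.commute[of _ "mult_order a"])
  show ?thesis
  proof
    assume "a ^ j = 1"
    moreover have "j mod mult_order a < mult_order a" using assms by simp
    ultimately show "mult_order a dvd j"
      using split not_less_Least[of "j mod mult_order a" "\<lambda>j. 0 < j \<and> a ^ j = 1"] eq by auto
  next
    assume "mult_order a dvd j"
    then show "a ^ j = 1" using split by simp
  qed
qed

theorem proposition3p1:
  fixes \<mu> lam :: "'k::{alg_closed_field, field_char_0}"
    and k n m :: nat
    and scaleA :: "'k \<Rightarrow> 'a::ring_1 \<Rightarrow> 'a"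
    and u v :: 'a
    and scaleT :: "'k \<Rightarrow> 'h::ring_1 \<Rightarrow> 'h"
    and \<Delta> :: "'h \<Rightarrow> ('h \<times> 'h \<Rightarrow>\<^sub>0 'k)"
    and \<epsilon> :: "'h \<Rightarrow> 'k"
    and S :: "'h \<Rightarrow> 'h"
    and g x :: 'h
  assumes "\<mu> \<noteq> 0" and "mult_order \<mu> = k" and "k > 1"
    and A: "quantum_plane \<mu> scaleA u v \<or> quantum_weyl \<mu> scaleA u v"
    and "n > 0" and "m \<ge> 2" and "m dvd n" and "mult_order lam = m"
    and T: "generalized_taft n lam m scaleT \<Delta> \<epsilon> S g x"
  shows
    "(\<forall>act. module_algebra scaleT \<Delta> \<epsilon> scaleA act \<longrightarrow>
        (linear_action scaleA u v g x act \<and> inner_faithful scaleT \<Delta> \<epsilon> S act \<longleftrightarrow>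
         n = lcm k m \<and>
         ((\<exists>\<eta>. \<eta> \<noteq> 0 \<and> action_a \<mu> lam \<eta> scaleA u v g x act \<and>
             (quantum_weyl \<mu> scaleA u v \<longrightarrow> lam = \<mu>\<^sup>2)) \<or>
          (\<exists>\<eta>. \<eta> \<noteq> 0 \<and> action_b \<mu> lam \<eta> scaleA u v g x act \<and>
             (quantum_weyl \<mu> scaleA u v \<longrightarrow> lam = inverse (\<mu>\<^sup>2)))))) \<and>
     (n = lcm k m \<longrightarrow>
        (\<forall>\<eta>. \<eta> \<noteq> 0 \<longrightarrow>
           ((quantum_weyl \<mu> scaleA u v \<longrightarrow> lam = \<mu>\<^sup>2) \<longrightarrow>
             (\<exists>act. module_algebra scaleT \<Delta> \<epsilon> scaleA act \<and>
                    action_a \<mu> lam \<eta> scaleA u v g x act)) \<and>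
           ((quantum_weyl \<mu> scaleA u v \<longrightarrow> lam = inverse (\<mu>\<^sup>2)) \<longrightarrow>
             (\<exists>act. module_algebra scaleT \<Delta> \<epsilon> scaleA act \<and>
                    action_b \<mu> lam \<eta> scaleA u v g x act))))"
proof -
  have \<mu>_iff: "\<mu> ^ j = 1 \<longleftrightarrow> k dvd j" and lam_iff: "lam ^ j = 1 \<longleftrightarrow> m dvd j" for j
    using power_eq_1_iff_mult_order_dvd[of \<mu> j] power_eq_1_iff_mult_order_dvd[of lam j] assms by simp_all
  have \<mu>: "\<mu> \<noteq> 0" "\<mu> \<noteq> 1" using \<mu>_iff[of 1] assms by auto
  interpret T: taft scaleT \<Delta> \<epsilon> S n m lam g x
    using assms lam_iff by (auto simp: taft_def taft_axioms_def generalized_taft_def Let_def)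
  \<comment> \<open>\<open>e\<close> is the constant \<open>u v - \<mu> v u\<close>, which is \<open>0\<close> or \<open>1\<close>\<close>
  obtain e where pres: "presented_by scaleA (case_gen u v) {quantum_relation \<mu> e}"
    and weyl: "quantum_weyl \<mu> scaleA u v \<longleftrightarrow> e \<noteq> 0"
  proof (cases "quantum_weyl \<mu> scaleA u v")
    case True
    then have "presented_by scaleA (case_gen u v) {quantum_relation \<mu> 1}"
      by (simp add: quantum_weyl_def quantum_relation_def Let_def)
    then show thesis using that[of 1] True by simp
  next
    case False
    then have "presented_by scaleA (case_gen u v) {quantum_relation \<mu> 0}"
      using A by (simp add: quantum_plane_def quantum_relation_def Let_def)
    then show thesis using that[of 0] False by simp
  qed
  interpret A: quantum_algebra scaleA \<mu> e u v
    using pres by (simp add: quantum_algebra_def quantum_algebra_axioms_def presented_by_def)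
  have lam0: "lam \<noteq> 0" by (rule T.lam_neq_0)
  have pow_a: "\<mu> ^ l = 1 \<and> (inverse lam * \<mu>) ^ l = 1 \<longleftrightarrow> lcm k m dvd l" for l
    using \<mu>_iff[of l] lam_iff[of l] by (auto simp: power_mult_distrib power_inverse)
  have pow_b: "inverse \<mu> ^ l = 1 \<and> (inverse lam * inverse \<mu>) ^ l = 1 \<longleftrightarrow> lcm k m dvd l" for l
    using \<mu>_iff[of l] lam_iff[of l] by (auto simp: power_mult_distrib power_inverse)
  have uv0: "u \<noteq> 0" "v \<noteq> 0"
    using A.monomials_independent(1)[of 1 0] A.monomials_independent(1)[of 0 1] by auto
  have indep': "q = 0 \<and> p = 0" if "scaleA q v + scaleA p u = 0" for p q
    using A.monomials_independent(1)[of p q] that by (simp add: add.commute)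
  have "linear_action scaleA u v g x act \<and> inner_faithful scaleT \<Delta> \<epsilon> S act \<longleftrightarrow>
      n = lcm k m \<and>
      ((\<exists>\<eta>. \<eta> \<noteq> 0 \<and> action_a \<mu> lam \<eta> scaleA u v g x act \<and> (e \<noteq> 0 \<longrightarrow> lam = \<mu>\<^sup>2)) \<or>
       (\<exists>\<eta>. \<eta> \<noteq> 0 \<and> action_b \<mu> lam \<eta> scaleA u v g x act \<and> (e \<noteq> 0 \<longrightarrow> lam = inverse (\<mu>\<^sup>2))))"
    (is "?lhs \<longleftrightarrow> n = lcm k m \<and> ?cases")
    if "module_algebra scaleT \<Delta> \<epsilon> scaleA act" for act
  proof -
    interpret act: taft_action scaleT \<Delta> \<epsilon> S n m lam g x scaleA act
      using that by unfold_locales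
    show ?thesis
    proof
      assume lhs: ?lhs
      then have cases: ?cases
        using act.linear_inner_faithful_cases[OF A.relation A.monomials_independent(2,1) A.generated(1) \<mu>] by blast
      have "k dvd n \<and> m dvd n \<and> n \<le> lcm k m"
        using cases
      proof (elim disjE exE conjE)
        fix \<eta> assume "action_a \<mu> lam \<eta> scaleA u v g x act"
        then have gu: "act g u = scaleA \<mu> u" and gv: "act g v = scaleA (inverse lam * \<mu>) v"
          by (simp_all add: action_a_def)
        show ?thesis
          using act.g_acts_with_order_n[OF _ A.generated(1) gu gv, of "lcm k m"] lhs pow_a[of "lcm k m"]
            assms(3,6) act.eigenvalue_power_n[OF gu] uv0 \<mu>_iff assms(7)
          by (auto simp: lcm_pos_nat)
      next
        fix \<eta> assume "action_b \<mu> lam \<eta> scaleA u v g x act"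
        then have gu: "act g u = scaleA (inverse lam * inverse \<mu>) u" and gv: "act g v = scaleA (inverse \<mu>) v"
          by (simp_all add: action_b_def)
        show ?thesis
          using act.g_acts_with_order_n[OF _ A.generated(1) gu gv, of "lcm k m"] lhs pow_b[of "lcm k m"]
            assms(3,6) act.eigenvalue_power_n[OF gv] uv0 \<mu>_iff assms(7)
          by (auto simp: lcm_pos_nat power_inverse)
      qed
      then have "lcm k m dvd n" "n \<le> lcm k m" by auto
      then have "n = lcm k m" using dvd_imp_le[of "lcm k m" n] assms(5) by simp
      then show "n = lcm k m \<and> ?cases" using cases by blast
    next
      assume "n = lcm k m \<and> ?cases"
      then have n: "n = lcm k m" and cases: ?cases by blast+
      show ?lhs using cases
      proof (elim disjE exE conjE)
        fix \<eta> assume "action_a \<mu> lam \<eta> scaleA u v g x act" and \<eta>: "\<eta> \<noteq> 0"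
        then have act: "act g u = scaleA \<mu> u" "act g v = scaleA (inverse lam * \<mu>) v" "act x u = 0" "act x v = scaleA \<eta> u"
          by (simp_all add: action_a_def)
        have "linear_action scaleA u v g x act"
          by (rule act.linear_actionI) (auto simp: act intro: A.span_base A.span_scale A.span_zero)
        moreover have "inner_faithful scaleT \<Delta> \<epsilon> S act"
          by (rule act.inner_faithful_triangular[OF A.monomials_independent(1) act \<eta>]) (use pow_a n in auto)
        ultimately show ?lhs ..
      next
        fix \<eta> assume "action_b \<mu> lam \<eta> scaleA u v g x act" and \<eta>: "\<eta> \<noteq> 0"
        then have act: "act g v = scaleA (inverse \<mu>) v" "act g u = scaleA (inverse lam * inverse \<mu>) u"
          "act x v = 0" "act x u = scaleA \<eta> v"
          by (simp_all add: action_b_def)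
        have "linear_action scaleA u v g x act"
          by (rule act.linear_actionI) (auto simp: act intro: A.span_base A.span_scale A.span_zero)
        moreover have "inner_faithful scaleT \<Delta> \<epsilon> S act"
          by (rule act.inner_faithful_triangular[OF indep' act \<eta>]) (use pow_b n in auto)
        ultimately show ?lhs ..
      qed
    qed
  qed
  moreover have "\<exists>act. module_algebra scaleT \<Delta> \<epsilon> scaleA act \<and> action_a \<mu> lam \<eta> scaleA u v g x act"
    if n: "n = lcm k m" and e: "e \<noteq> 0 \<longrightarrow> lam = \<mu>\<^sup>2" for \<eta>
  proof -
    let ?\<delta> = "inverse lam * \<mu>"
    define Y where "Y w = (scaleA \<mu> (u * fst w), u * snd w)" for w
    define Z where "Z w = (scaleA ?\<delta> (v * fst w) + scaleA \<eta> (u * snd w), v * snd w)" for w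
    have Y: "Vector_Spaces.linear (pair_scale scaleA) (pair_scale scaleA) Y"
      and Z: "Vector_Spaces.linear (pair_scale scaleA) (pair_scale scaleA) Z"
      by (simp_all add: Vector_Spaces.linear_iff A.vector_space_pair_scale Y_def Z_def pair_scale_def plus_prod_def
          distrib_left A.scale_right_distrib A.scale_mult_right[symmetric] mult_ac add_ac)
    have e\<delta>: "e * (\<mu> * ?\<delta>) = e" using e \<mu> by (cases "e = 0") (simp_all add: power2_eq_square field_simps)
    have YZ: "Y (Z w) = pair_scale scaleA \<mu> (Z (Y w)) + pair_scale scaleA e w" for w
    proof -
      have uv: "u * (v * b) = scaleA \<mu> (v * (u * b)) + scaleA e b" for b
        by (simp add: mult.assoc[symmetric] A.relation distrib_right A.scale_mult_left[symmetric])
      have "scaleA (\<mu> * ?\<delta>) (scaleA e b) = scaleA e b" for b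
        using e\<delta> by (simp add: mult_ac)
      then show ?thesis
        by (simp add: Y_def Z_def pair_scale_def plus_prod_def distrib_left A.scale_right_distrib
            A.scale_mult_right[symmetric] uv mult_ac add_ac)
    qed
    obtain \<rho> where \<rho>: "\<And>w. Vector_Spaces.linear scaleA (pair_scale scaleA) (\<lambda>a. \<rho> a w)"
      "\<And>w. \<rho> 1 w = w" "\<And>a b w. \<rho> (a * b) w = \<rho> a (\<rho> b w)" "\<rho> u = Y" "\<rho> v = Z"
      by (rule A.quantum_rep[OF A.vector_space_pair_scale Y Z YZ]) (rule that; assumption)
    show ?thesis
      using T.triangular_action_exists[OF A.k_algebra_axioms A.generated(1) \<rho>(1-3), of \<mu> ?\<delta> \<eta>] pow_a[of n] n lam0
      by (simp add: \<rho>(4,5) Y_def Z_def action_a_def)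
  qed
  moreover have "\<exists>act. module_algebra scaleT \<Delta> \<epsilon> scaleA act \<and> action_b \<mu> lam \<eta> scaleA u v g x act"
    if n: "n = lcm k m" and e: "e \<noteq> 0 \<longrightarrow> lam = inverse (\<mu>\<^sup>2)" for \<eta>
  proof -
    let ?\<alpha> = "inverse \<mu>" and ?\<delta> = "inverse lam * inverse \<mu>"
    define Y where "Y w = (scaleA ?\<alpha> (v * fst w), v * snd w)" for w
    define Z where "Z w = (scaleA ?\<delta> (u * fst w) + scaleA \<eta> (v * snd w), u * snd w)" for w
    have Y: "Vector_Spaces.linear (pair_scale scaleA) (pair_scale scaleA) Y"
      and Z: "Vector_Spaces.linear (pair_scale scaleA) (pair_scale scaleA) Z"
      by (simp_all add: Vector_Spaces.linear_iff A.vector_space_pair_scale Y_def Z_def pair_scale_def plus_prod_def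
          distrib_left A.scale_right_distrib A.scale_mult_right[symmetric] mult_ac add_ac)
    have e\<delta>: "e * (?\<alpha> * ?\<delta>) = e" using e \<mu> by (cases "e = 0") (simp_all add: power2_eq_square field_simps)
    have ZY: "Z (Y w) = pair_scale scaleA \<mu> (Y (Z w)) + pair_scale scaleA e w" for w
    proof -
      have uv: "u * (v * b) = scaleA \<mu> (v * (u * b)) + scaleA e b" for b
        by (simp add: mult.assoc[symmetric] A.relation distrib_right A.scale_mult_left[symmetric])
      have e': "e * (inverse \<mu> * (inverse \<mu> * inverse lam)) = e" using e\<delta> by (simp only: mult_ac)
      have \<mu>': "\<mu> * (inverse \<mu> * t) = t" for t using \<mu> by simp
      show ?thesis
        by (simp add: e' \<mu>' \<mu> Y_def Z_def pair_scale_def plus_prod_def distrib_left A.scale_right_distrib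
            A.scale_mult_right[symmetric] uv mult_ac add_ac)
    qed
    obtain \<rho> where \<rho>: "\<And>w. Vector_Spaces.linear scaleA (pair_scale scaleA) (\<lambda>a. \<rho> a w)"
      "\<And>w. \<rho> 1 w = w" "\<And>a b w. \<rho> (a * b) w = \<rho> a (\<rho> b w)" "\<rho> u = Z" "\<rho> v = Y"
      by (rule A.quantum_rep[OF A.vector_space_pair_scale Z Y ZY]) (rule that; assumption)
    show ?thesis
      using T.triangular_action_exists[OF A.k_algebra_axioms A.generated(2) \<rho>(1-3), of ?\<alpha> ?\<delta> \<eta>] pow_b[of n] n lam0
      by (auto simp add: \<rho>(4,5) Y_def Z_def action_b_def)
  qed
  ultimately show ?thesis unfolding weyl by blast
qed

end
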